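(* Let $K_n=\Gamma_{\phi^{(n)}}^\dagger\Gamma_{\phi^{(n)}}$ where $\phi^{(n)}(t)=\sum_{j=1}^N\xi_j^\dagger e^{-\bar\lambda_jt}$ $(t>0)$ with $\Re\lambda_j>0$, and let $\tau_{K_n}$ be the $\tau$-function of $K_n$. (i) Suppose that $\phi^{(n)}:(0,\infty)\to\mathbf C$. Then $$\tau_{K_n}(x)=\sum_{\ell=0}^N(-1)^\ell\sum_{T,S:\,\sharp S=\sharp T=\ell}\ \prod_{j\in S}\xi_je^{-2\lambda_jx}\prod_{k\in T}\bar\xi_ke^{-2\bar\lambda_kx}\ \Bigl(\det\Bigl[\frac1{\lambda_j+\bar\lambda_k}\Bigr]_{j\in S,k\in T}\Bigr)^2,$$ where $S,T$ run over subsets of $\{1,\dots,N\}$. (ii) Suppose that $\phi^{(n)}:(0,\infty)\to E$ where $E$ has orthonormal basis $(e_r)_{r=1}^\nu$, and let $\xi_j^{(r)}=\langle\xi_j,e_r\rangle$. Then $$\tau_{K_n}(x)=\sum_{S,T:\,\sharp S=\sharp T}(-1)^{\sharp S}\det\Bigl[\frac{\xi_j^{(r)}e^{-2\lambda_jx}}{\lambda_j+\bar\lambda_k}\Bigr]_{j\in S;(k,r)\in T}\det\Bigl[\frac{\bar\xi_k^{(r)}e^{-2\bar\lambda_kx}}{\lambda_m+\bar\lambda_k}\Bigr]_{m\in S;(k,r)\in T},$$ and the sum is over all pairs of subsets $S\subseteq\{1,\dots,N\}$ and $T\subseteq\{1,\dots,N\}\times\{1,\dots,\nu\}$ that have equal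 cardinality.
   Context: The Hankel operator with symbol $\phi$ is $\Gamma_\phi h(x)=\int_0^\infty\phi(x+y)h(y)\,dy$, from $L^2(0,\infty)$ to $L^2((0,\infty);E)$; $\dagger$ denotes adjoint. The $\tau$-function is $\tau_{K_n}(x)=\det(I-K_nP_{(x,\infty)})$, where $P_{(x,\infty)}$ is the orthogonal projection onto $L^2(x,\infty)$; the paper identifies this with $\det\bigl(I-\Gamma_{\phi^{(n)}_{(x)}}^\dagger\Gamma_{\phi^{(n)}_{(x)}}\bigr)$, where $\phi^{(n)}_{(x)}(s)=\phi^{(n)}(s+2x)$. The exponentials $e^{-\lambda_js}$ $(1\le j\le N)$ are linearly independent in $L^2(0,\infty)$. The $\xi_j$ are vectors in $E$ (scalars in (i)), identified with row vectors in $M_{1,\nu}(\mathbf C)$ with entries $\xi_j^{(r)}$, and $\langle\xi_j,\xi_k\rangle=\sum_r\xi_j^{(r)}\bar\xi_k^{(r)}$. $\sharp S$ is the number of elements of $S$; the terms with $S=T=\emptyset$ equal $1$.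
   Formalization: The τ-function is taken as det(I−Γ†Γ) with the symbol φ(s+2x), not as det(I−K_nP_(x,∞)); for K_n=Γ†Γ the two differ (for N=1 the latter has e^{-2Re(λ)x} in place of e^{-4Re(λ)x}), and the stated formulas hold only for the former. *)

theory Defs
  imports "HOL-Analysis.Analysis" "Jordan_Normal_Form.Determinant"
begin

section \<open>Separable complex Hilbert spaces\<close>

text \<open>The inner product is linear in the first argument and conjugate linear in the second.
  Definiteness needs no axiom of its own: it follows from the last one, because
  \<^term>\<open>norm\<close> is a norm.\<close>

class complex_hilbert = banach + second_countable_topology +
  fixes scaleC :: "complex \<Rightarrow> 'a \<Rightarrow> 'a"  (infixr "*\<^sub>C" 75)
    and cinner :: "'a \<Rightarrow> 'a \<Rightarrow> complex"
  assumes scaleC_add_right: "a *\<^sub>C (u + v) = a *\<^sub>C u + a *\<^sub>C v"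
    and scaleC_add_left: "(a + b) *\<^sub>C u = a *\<^sub>C u + b *\<^sub>C u"
    and scaleC_scaleC: "a *\<^sub>C (b *\<^sub>C u) = (a * b) *\<^sub>C u"
    and scaleR_scaleC: "scaleR r u = complex_of_real r *\<^sub>C u"
    and cinner_commute: "cinner u v = cnj (cinner v u)"
    and cinner_add_left: "cinner (u + v) w = cinner u w + cinner v w"
    and cinner_scaleC_left: "cinner (a *\<^sub>C u) v = a * cinner u v"
    and norm_eq_sqrt_cinner: "norm u = sqrt (Re (cinner u u))"

instantiation complex :: complex_hilbert
begin

definition scaleC_complex :: "complex \<Rightarrow> complex \<Rightarrow> complex"
  where "scaleC_complex a u = a * u"

definition cinner_complex :: "complex \<Rightarrow> complex \<Rightarrow> complex"
  where "cinner_complex u v = u * cnj v"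

instance
proof
  fix a b u v w :: complex and r :: real
  show "a *\<^sub>C (u + v) = a *\<^sub>C u + a *\<^sub>C v"
    by (simp add: scaleC_complex_def algebra_simps)
  show "(a + b) *\<^sub>C u = a *\<^sub>C u + b *\<^sub>C u"
    by (simp add: scaleC_complex_def algebra_simps)
  show "a *\<^sub>C (b *\<^sub>C u) = (a * b) *\<^sub>C u"
    by (simp add: scaleC_complex_def)
  show "scaleR r u = complex_of_real r *\<^sub>C u"
    by (simp add: scaleC_complex_def scaleR_conv_of_real)
  show "cinner u v = cnj (cinner v u)"
    by (simp add: cinner_complex_def)
  show "cinner (u + v) w = cinner u w + cinner v w"
    by (simp add: cinner_complex_def algebra_simps)
  show "cinner (a *\<^sub>C u) v = a * cinner u v"
    by (simp add: cinner_complex_def scaleC_complex_def)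
  show "norm u = sqrt (Re (cinner u u))"
    by (simp add: cinner_complex_def cmod_def power2_eq_square)
qed

end

instantiation Finite_Cartesian_Product.vec :: ("{euclidean_space, complex_hilbert}", finite) complex_hilbert
begin

definition scaleC_vec :: "complex \<Rightarrow> 'a ^ 'b \<Rightarrow> 'a ^ 'b"
  where "scaleC_vec a u = vec_lambda (\<lambda>i. a *\<^sub>C vec_nth u i)"

definition cinner_vec :: "'a ^ 'b \<Rightarrow> 'a ^ 'b \<Rightarrow> complex"
  where "cinner_vec u v = (\<Sum>i\<in>UNIV. cinner (vec_nth u i) (vec_nth v i))"

instance
proof
  fix a b :: complex and u v w :: "'a ^ 'b" and r :: real
  show "a *\<^sub>C (u + v) = a *\<^sub>C u + a *\<^sub>C v"
    by (simp add: scaleC_vec_def Finite_Cartesian_Product.vec_eq_iff scaleC_add_right)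
  show "(a + b) *\<^sub>C u = a *\<^sub>C u + b *\<^sub>C u"
    by (simp add: scaleC_vec_def Finite_Cartesian_Product.vec_eq_iff scaleC_add_left)
  show "a *\<^sub>C (b *\<^sub>C u) = (a * b) *\<^sub>C u"
    by (simp add: scaleC_vec_def Finite_Cartesian_Product.vec_eq_iff scaleC_scaleC)
  show "scaleR r u = complex_of_real r *\<^sub>C u"
    by (simp add: scaleC_vec_def Finite_Cartesian_Product.vec_eq_iff scaleR_scaleC)
  show "cinner u v = cnj (cinner v u)"
    unfolding cinner_vec_def cnj_sum by (rule sum.cong[OF refl], rule cinner_commute)
  show "cinner (u + v) w = cinner u w + cinner v w"
    by (simp add: cinner_vec_def cinner_add_left sum.distrib)
  show "cinner (a *\<^sub>C u) v = a * cinner u v"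
    by (simp add: cinner_vec_def scaleC_vec_def cinner_scaleC_left sum_distrib_left)
  have "Re (cinner z z) = (norm z)\<^sup>2" for z :: 'a
  proof -
    have "0 \<le> Re (cinner z z)"
      using norm_ge_zero[of z] by (simp add: norm_eq_sqrt_cinner)
    then show ?thesis by (simp add: norm_eq_sqrt_cinner)
  qed
  then show "norm u = sqrt (Re (cinner u u))"
    by (simp add: cinner_vec_def norm_vec_def L2_set_def)
qed

end

definition orthonormal_basis :: "nat \<Rightarrow> (nat \<Rightarrow> 'e::complex_hilbert) \<Rightarrow> bool"
  where "orthonormal_basis \<nu> e \<longleftrightarrow>
    (\<forall>r\<in>{1..\<nu>}. \<forall>s\<in>{1..\<nu>}. cinner (e r) (e s) = (if r = s then 1 else 0)) \<and>
    (\<forall>v. \<exists>c. v = (\<Sum>r = 1..\<nu>. c r *\<^sub>C e r))"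

text \<open>With respect to an orthonormal basis, a vector is a row vector of coordinates and its
  dagger is the column vector of conjugate coordinates, which is again read as an element of
  the space.\<close>

definition dagger :: "nat \<Rightarrow> (nat \<Rightarrow> 'e::complex_hilbert) \<Rightarrow> 'e \<Rightarrow> 'e"
  where "dagger \<nu> e v = (\<Sum>r = 1..\<nu>. cnj (cinner v (e r)) *\<^sub>C e r)"


section \<open>Square integrable functions and Hankel operators on the half line\<close>

abbreviation half_line :: "real measure"
  where "half_line \<equiv> restrict_space lborel {0<..}"

text \<open>Elements of \<open>L\<^sup>2((0,\<infinity>); E)\<close> are represented by functions, and operators by maps on
  functions; functions that agree almost everywhere are not identified.\<close>

definition L2 :: "(real \<Rightarrow> 'e::complex_hilbert) set"
  where "L2 = {f \<in> borel_measurable half_line. integrable half_line (\<lambda>s. (norm (f s))\<^sup>2)}"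

definition L2_inner :: "(real \<Rightarrow> 'e::complex_hilbert) \<Rightarrow> (real \<Rightarrow> 'e) \<Rightarrow> complex"
  where "L2_inner f g = (\<integral>s. cinner (f s) (g s) \<partial>half_line)"

text \<open>Unique up to almost everywhere equality of the values on \<^term>\<open>L2\<close>, as for
  \<^term>\<open>adjoint\<close>.\<close>

definition L2_adjoint ::
    "((real \<Rightarrow> 'd::complex_hilbert) \<Rightarrow> (real \<Rightarrow> 'e::complex_hilbert)) \<Rightarrow> (real \<Rightarrow> 'e) \<Rightarrow> (real \<Rightarrow> 'd)"
  where "L2_adjoint A = (SOME B. (\<forall>g\<in>L2. B g \<in> L2) \<and>
    (\<forall>h\<in>L2. \<forall>g\<in>L2. L2_inner (A h) g = L2_inner h (B g)))"

definition hankel :: "(real \<Rightarrow> 'e::complex_hilbert) \<Rightarrow> (real \<Rightarrow> complex) \<Rightarrow> (real \<Rightarrow> 'e)"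
  where "hankel \<phi> h = (\<lambda>x. \<integral>y. h y *\<^sub>C \<phi> (x + y) \<partial>half_line)"


section \<open>Fredholm determinants and the tau function\<close>

definition kernel_of :: "((real \<Rightarrow> complex) \<Rightarrow> (real \<Rightarrow> complex)) \<Rightarrow> (real \<Rightarrow> real \<Rightarrow> complex) \<Rightarrow> bool"
  where "kernel_of K k \<longleftrightarrow>
    (\<forall>h\<in>L2. AE s in half_line.
      integrable half_line (\<lambda>t. k s t * h t) \<and> K h s = (\<integral>t. k s t * h t \<partial>half_line))"

definition fredholm_minor :: "(real \<Rightarrow> real \<Rightarrow> complex) \<Rightarrow> nat \<Rightarrow> (nat \<Rightarrow> real) \<Rightarrow> complex"
  where "fredholm_minor k n s = Determinant.det (Matrix.mat n n (\<lambda>(i, j). k (s i) (s j)))"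

text \<open>The determinant of \<open>I - K\<close>, for an integral operator \<open>K\<close> with continuous kernel \<open>k\<close>, is
  Fredholm's series
  \<open>\<Sum>n. (-1)^n / n! * \<integral> det [k (s\<^sub>i) (s\<^sub>j)] ds\<^sub>1 \<dots> ds\<^sub>n\<close>.
  The operator determines its continuous kernel on \<open>(0,\<infinity>) \<times> (0,\<infinity>)\<close>.\<close>

definition fredholm_det :: "((real \<Rightarrow> complex) \<Rightarrow> (real \<Rightarrow> complex)) \<Rightarrow> complex"
  where "fredholm_det K = (THE d. \<exists>k.
    continuous_on ({0<..} \<times> {0<..}) (\<lambda>(s, t). k s t) \<and> kernel_of K k \<and>
    (\<forall>n. integrable (\<Pi>\<^sub>M i\<in>{..<n}. half_line) (fredholm_minor k n)) \<and>
    (\<lambda>n. (- 1) ^ n / fact n * (\<integral>s. fredholm_minor k n s \<partial>(\<Pi>\<^sub>M i\<in>{..<n}. half_line))) sums d)"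

text \<open>The kernel \<open>\<phi> (s + t + 2 * x)\<close> is that of the Hankel operator with symbol \<open>\<phi>\<close>,
  compressed to \<open>L\<^sup>2(x,\<infinity>)\<close> on both sides and translated back to \<open>(0,\<infinity>)\<close>. So for
  \<open>K = \<Gamma>\<^sup>\<dagger> \<Gamma>\<close> the projection onto \<open>L\<^sup>2(x,\<infinity>)\<close> in the tau function acts
  on both factors \<open>\<Gamma>\<close> and \<open>\<Gamma>\<^sup>\<dagger>\<close>; projecting the product \<open>\<Gamma>\<^sup>\<dagger> \<Gamma>\<close> only
  would shift the symbol by \<open>x\<close> instead of \<open>2 * x\<close>.\<close>

definition shift_symbol :: "real \<Rightarrow> (real \<Rightarrow> 'e) \<Rightarrow> real \<Rightarrow> 'e"
  where "shift_symbol x \<phi> = (\<lambda>s. \<phi> (s + 2 * x))"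

definition hankel_square :: "(real \<Rightarrow> 'e::complex_hilbert) \<Rightarrow> (real \<Rightarrow> complex) \<Rightarrow> (real \<Rightarrow> complex)"
  where "hankel_square \<phi> = L2_adjoint (hankel \<phi>) \<circ> hankel \<phi>"

definition tau :: "(real \<Rightarrow> 'e::complex_hilbert) \<Rightarrow> real \<Rightarrow> complex"
  where "tau \<phi> x = fredholm_det (hankel_square (shift_symbol x \<phi>))"

definition exp_symbol :: "nat \<Rightarrow> (nat \<Rightarrow> complex) \<Rightarrow> (nat \<Rightarrow> 'e::complex_hilbert) \<Rightarrow> real \<Rightarrow> 'e"
  where "exp_symbol N lam v = (\<lambda>t. \<Sum>j = 1..N. exp (- cnj (lam j) * complex_of_real t) *\<^sub>C v j)"

definition exps_independent :: "nat \<Rightarrow> (nat \<Rightarrow> complex) \<Rightarrow> bool"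
  where "exps_independent N lam \<longleftrightarrow>
    (\<forall>c. (AE s in half_line. (\<Sum>j = 1..N. c j * exp (- lam j * complex_of_real s)) = 0)
      \<longrightarrow> (\<forall>j\<in>{1..N}. c j = 0))"


section \<open>Determinants with rows and columns indexed by finite sets\<close>

text \<open>The rows and columns are listed explicitly. Reordering a list changes the determinant at
  most by a sign, which cancels in a product of two determinants over the same lists.\<close>

definition det_on :: "'i list \<Rightarrow> 'j list \<Rightarrow> ('i \<Rightarrow> 'j \<Rightarrow> complex) \<Rightarrow> complex"
  where "det_on is js a =
    Determinant.det (Matrix.mat (length is) (length js) (\<lambda>(p, q). a (is ! p) (js ! q)))"

definition pairs_list :: "nat \<Rightarrow> nat \<Rightarrow> (nat \<times> nat) set \<Rightarrow> (nat \<times> nat) list"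
  where "pairs_list N \<nu> T = filter (\<lambda>p. p \<in> T) (List.product [1..<Suc N] [1..<Suc \<nu>])"

end

theory Submission
  imports Defs "HOL-Probability.Sinc_Integral"
begin

text \<open>
  The symbol is a finite sum of exponentials, so everything reduces to finite matrices.

  Let \<open>v\<^sub>j\<close> be the coefficients of the symbol, with the factor
  \<open>exp (- 2 * cnj (lam j) * x)\<close> produced by the shift absorbed. The Hankel operator maps \<open>h\<close>
  to a combination of the functions \<open>s \<mapsto> exp (- cnj (lam j) * s) v\<^sub>j\<close> whose coefficients
  are values of the Laplace transform of \<open>h\<close>. Its adjoint has the same form, and
  \<open>\<Gamma>\<^sup>\<dagger> \<Gamma>\<close> therefore has the separated kernel \<open>\<Sum>k. a\<^sub>k(s) b\<^sub>k(t)\<close> with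
  \<open>a\<^sub>k(s) = exp (- lam k * s)\<close> and
  \<open>b\<^sub>k(t) = \<Sum>j. \<langle>v\<^sub>j, v\<^sub>k\<rangle> / (lam k + cnj (lam j)) * exp (- cnj (lam j) * t)\<close>
  (lemma \<open>kernel_of_hankel_square\<close>).

  The discrete Cauchy-Binet formula splits each Fredholm minor \<open>det [k(s\<^sub>p, s\<^sub>q)]\<close> into
  products \<open>det [a\<^sub>k(s\<^sub>p)] det [b\<^sub>k(s\<^sub>p)]\<close>, one for every set \<open>S\<close> of \<open>n\<close> indices.
  Its continuous counterpart, Andreief's identity, integrates such a product to
  \<open>n!\<close> times the principal minor over \<open>S\<close> of the matrix of the integrals \<open>\<integral> a\<^sub>l b\<^sub>k\<close>.
  The Fredholm series thus terminates and is the alternating sum of the principal minors of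
  that matrix (lemma \<open>fredholm_det_finite_rank\<close>). Its entries are
  \<open>\<Sum>j. \<langle>v\<^sub>j, v\<^sub>k\<rangle> / ((lam k + cnj (lam j)) * (lam l + cnj (lam j)))\<close>. Expanding the inner product in
  coordinates exhibits the matrix as a product \<open>A B\<^sup>T\<close> with columns indexed by
  the pairs \<open>(j, r)\<close>, and a second use of Cauchy-Binet turns each principal minor into the
  sum over \<open>T\<close> in the statement. In the scalar case the numerators are scalings of rows and columns of
  a Cauchy matrix and come out of the determinants, which leaves the square.

  Two points of rigour concern choices in the definitions. The adjoint is only determined up to
  null sets, which is harmless because a kernel represents an operator up to null sets
  (lemma \<open>L2_adjoint_AE\<close>). The determinant is defined through some continuous kernel, and
  it is well defined because a continuous kernel is determined by its operator
  (lemma \<open>kernel_of_unique\<close>).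
\<close>

section \<open>Determinants over lists of indices\<close>

lemma det_on_expand:
  assumes "length is = n" "length js = n"
  shows "det_on is js a =
    (\<Sum>p | p permutes {0..<n}. signof p * (\<Prod>i = 0..<n. a (is ! i) (js ! p i)))"
proof -
  let ?A = "Matrix.mat n n (\<lambda>(i, j). a (is ! i) (js ! j))"
  have A: "?A \<in> carrier_mat n n" by simp
  have "det_on is js a = Determinant.det ?A"
    using assms by (simp add: det_on_def)
  also have "\<dots> = (\<Sum>p | p permutes {0..<n}. signof p * (\<Prod>i = 0..<n. ?A $$ (i, p i)))"
    by (rule det_def'[OF A])
  also have "\<dots> = (\<Sum>p | p permutes {0..<n}. signof p * (\<Prod>i = 0..<n. a (is ! i) (js ! p i)))"
  proof (intro sum.cong refl arg_cong2[where f = "(*)"] prod.cong)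
    fix p i assume "p \<in> {p. p permutes {0..<n}}" "i \<in> {0..<n}"
    moreover from this have "p i < n"
      using permutes_in_image[of p "{0..<n}" i] by simp
    ultimately show "?A $$ (i, p i) = a (is ! i) (js ! p i)" by simp
  qed
  finally show ?thesis .
qed

lemma det_on_cong:
  assumes "length is = length js"
    and "\<And>i j. i \<in> set is \<Longrightarrow> j \<in> set js \<Longrightarrow> a i j = b i j"
  shows "det_on is js a = det_on is js b"
  unfolding det_on_def
  by (rule arg_cong[where f = Determinant.det], rule Matrix.eq_matI) (auto simp: assms)

lemma det_on_transpose:
  assumes "length is = length js"
  shows "det_on js is (\<lambda>j i. a i j) = det_on is js a"
proof -
  let ?A = "Matrix.mat (length is) (length is) (\<lambda>(p, q). a (is ! p) (js ! q))"
  have "Matrix.mat (length is) (length is) (\<lambda>(p, q). a (is ! q) (js ! p)) = transpose_mat ?A"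
    by (rule Matrix.eq_matI) auto
  then show ?thesis
    using det_transpose[of ?A "length is"] assms by (simp add: det_on_def)
qed

lemma det_on_permute_rows:
  assumes "length is = n" "length js = n" and p: "p permutes {0..<n}"
  shows "det_on (map (\<lambda>i. is ! p i) [0..<n]) js a = signof p * det_on is js a"
proof -
  let ?A = "Matrix.mat n n (\<lambda>(i, j). a (is ! i) (js ! j))"
  have "Matrix.mat n n (\<lambda>(i, j). ?A $$ (p i, j)) =
      Matrix.mat n n (\<lambda>(i, j). a (map (\<lambda>i. is ! p i) [0..<n] ! i) (js ! j))"
    using permutes_in_image[OF p] by (intro Matrix.eq_matI) auto
  then show ?thesis
    using det_permute_rows[of ?A n p] assms by (simp add: det_on_def)
qed

lemma det_on_permute_cols:
  assumes "length is = n" "length js = n" "p permutes {0..<n}"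
  shows "det_on is (map (\<lambda>i. js ! p i) [0..<n]) a = signof p * det_on is js a"
proof -
  let ?js = "map (\<lambda>i. js ! p i) [0..<n]"
  have "det_on is ?js a = det_on ?js is (\<lambda>j i. a i j)"
    using assms by (intro det_on_transpose[symmetric]) simp
  also have "\<dots> = signof p * det_on js is (\<lambda>j i. a i j)"
    using assms by (intro det_on_permute_rows)
  also have "det_on js is (\<lambda>j i. a i j) = det_on is js a"
    using assms by (intro det_on_transpose) simp
  finally show ?thesis .
qed

lemma det_on_repeated_col:
  assumes "length is = length js" and "\<not> distinct js"
  shows "det_on is js a = 0"
proof -
  from assms(2) obtain p q where pq: "p < length js" "q < length js" "p \<noteq> q" "js ! p = js ! q"
    by (auto simp: distinct_conv_nth)
  let ?A = "Matrix.mat (length js) (length js) (\<lambda>(p, q). a (is ! p) (js ! q))"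
  have "col ?A p = col ?A q" using pq by (intro Matrix.eq_vecI) auto
  then have "Determinant.det ?A = 0"
    using pq by (intro det_identical_columns[of ?A "length js" p q]) auto
  then show ?thesis using assms by (simp add: det_on_def)
qed

lemma det_on_scale:
  assumes "length is = length js" and "distinct is" and "distinct js"
  shows "det_on is js (\<lambda>i j. u i * v j * a i j) =
    (\<Prod>i\<in>set is. u i) * (\<Prod>j\<in>set js. v j) * det_on is js a"
proof -
  let ?n = "length js"
  have list_prod: "(\<Prod>i = 0..<length xs. f (xs ! i)) = (\<Prod>x\<in>set xs. f x)"
    if "distinct xs" for xs :: "'x list" and f :: "'x \<Rightarrow> complex"
    using prod.reindex_bij_betw[OF bij_betw_nth[OF that], of "{0..<length xs}" "set xs" f]
    by (simp add: lessThan_atLeast0)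
  have "(\<Prod>i = 0..<?n. u (is ! i) * v (js ! p i) * a (is ! i) (js ! p i)) =
      (\<Prod>i\<in>set is. u i) * (\<Prod>j\<in>set js. v j) * (\<Prod>i = 0..<?n. a (is ! i) (js ! p i))"
    if "p permutes {0..<?n}" for p
    using prod.permute[OF that, of "\<lambda>i. v (js ! i)"] list_prod[OF assms(2), of u]
      list_prod[OF assms(3), of v] assms(1)
    by (simp add: prod.distrib comp_def)
  then have "signof p * (\<Prod>i = 0..<?n. u (is ! i) * v (js ! p i) * a (is ! i) (js ! p i)) =
      (\<Prod>i\<in>set is. u i) * (\<Prod>j\<in>set js. v j) *
      (signof p * (\<Prod>i = 0..<?n. a (is ! i) (js ! p i)))"
    if "p \<in> {p. p permutes {0..<?n}}" for p
    using that by (simp only: mem_Collect_eq mult_ac)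
  then show ?thesis
    unfolding det_on_expand[OF assms(1) refl] sum_distrib_left by (intro sum.cong refl)
qed

text \<open>An injective map from \<open>{0..<n}\<close> to \<open>Q\<close> is the same as its image \<open>T\<close> together with
  the permutation that orders \<open>T\<close> differently from the fixed enumeration \<open>en T\<close>. This regrouping
  is the combinatorial core of the Cauchy-Binet formula, where \<open>F f\<close> contains a determinant with
  columns \<open>f\<close> and therefore vanishes unless \<open>f\<close> is injective.\<close>

lemma sum_maps_by_image:
  fixes F :: "(nat \<Rightarrow> 'q) \<Rightarrow> complex"
  assumes Q: "finite Q"
    and en: "\<And>T. T \<subseteq> Q \<Longrightarrow> distinct (en T) \<and> set (en T) = T"
    and restr: "\<And>f. F (restrict f {0..<n}) = F f"
    and not_inj: "\<And>f. \<not> inj_on f {0..<n} \<Longrightarrow> F f = 0"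
  shows "(\<Sum>f \<in> PiE {0..<n} (\<lambda>_. Q). F f) =
    (\<Sum>T | T \<subseteq> Q \<and> card T = n. \<Sum>p | p permutes {0..<n}. F (\<lambda>i. en T ! p i))"
proof -
  let ?I = "{0..<n}"
  let ?inj = "{f \<in> PiE ?I (\<lambda>_. Q). inj_on f ?I}"
  let ?TP = "{T. T \<subseteq> Q \<and> card T = n} \<times> {p. p permutes ?I}"
  let ?h = "\<lambda>(T, p). restrict (\<lambda>i. en T ! p i) ?I"
  have en_bij: "bij_betw ((!) (en T)) ?I T" if "T \<subseteq> Q" "card T = n" for T
    using en[OF that(1)] that(2) distinct_card[of "en T"]
    by (intro bij_betw_nth) (auto simp: lessThan_atLeast0)
  have h_bij: "bij_betw (\<lambda>i. en T ! p i) ?I T"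
    if "T \<subseteq> Q" "card T = n" "p permutes ?I" for T p
    using bij_betw_trans[OF permutes_imp_bij[OF that(3)] en_bij[OF that(1,2)]]
    by (simp add: comp_def)
  have "bij_betw ?h ?TP ?inj"
  proof (rule bij_betw_imageI)
    show "inj_on ?h ?TP"
    proof (rule inj_onI, clarsimp)
      fix T p T' p'
      assume T: "T \<subseteq> Q" "n = card T" "p permutes {0..<card T}"
        and T': "T' \<subseteq> Q" "card T' = card T" "p' permutes {0..<card T}"
        and eq: "restrict (\<lambda>i. en T ! p i) {0..<card T} = restrict (\<lambda>i. en T' ! p' i) {0..<card T}"
      have eq': "en T ! p i = en T' ! p' i" if "i \<in> {0..<card T}" for i
        using fun_cong[OF eq, of i] that by simp
      have "T = (\<lambda>i. en T ! p i) ` ?I"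
        using h_bij[of T p] T by (simp add: bij_betw_def)
      also have "\<dots> = (\<lambda>i. en T' ! p' i) ` ?I"
        using eq' T(2) by (intro image_cong) auto
      also have "\<dots> = T'"
        using h_bij[of T' p'] T T' by (simp add: bij_betw_def)
      finally have TT': "T = T'" .
      have "p i = p' i" for i
      proof (cases "i \<in> {0..<card T}")
        case True
        have "p i \<in> ?I" "p' i \<in> ?I"
          using True T T' permutes_in_image by fastforce+
        then show ?thesis
          using eq'[OF True] en_bij[of T] T TT' by (auto simp: bij_betw_def dest: inj_onD)
      next
        case False
        then show ?thesis using T(3) T'(3) by (simp add: permutes_def)
      qed
      then show "T = T' \<and> p = p'" using TT' by auto
    qed
    show "?h ` ?TP = ?inj"
    proof (intro equalityI subsetI)
      fix f assume "f \<in> ?h ` ?TP"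
      then obtain T p where Tp: "T \<subseteq> Q" "card T = n" "p permutes ?I"
        and f: "f = restrict (\<lambda>i. en T ! p i) ?I" by auto
      show "f \<in> ?inj"
        using h_bij[OF Tp] Tp(1) unfolding f bij_betw_def
        by (auto simp: inj_on_restrict_eq)
    next
      fix f assume f: "f \<in> ?inj"
      define T where "T = f ` ?I"
      define p where "p i = (if i \<in> ?I then inv_into ?I ((!) (en T)) (f i) else i)" for i
      have T: "T \<subseteq> Q" "card T = n"
        using f by (auto simp: T_def card_image)
      have "bij_betw f ?I T" using f by (auto simp: T_def bij_betw_def)
      then have "bij_betw (inv_into ?I ((!) (en T)) \<circ> f) ?I ?I"
        using bij_betw_inv_into[OF en_bij[OF T]] by (rule bij_betw_trans)
      then have "bij_betw p ?I ?I"
        by (rule bij_betw_cong[THEN iffD1, rotated]) (simp add: p_def)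
      then have p: "p permutes ?I"
        by (rule bij_imp_permutes) (auto simp: p_def)
      have "f = ?h (T, p)"
      proof
        fix i
        show "f i = ?h (T, p) i"
        proof (cases "i \<in> ?I")
          case True
          then have "f i \<in> (!) (en T) ` ?I"
            using en_bij[OF T] by (auto simp: T_def bij_betw_def)
          then show ?thesis using True by (simp add: p_def f_inv_into_f)
        next
          case False
          then show ?thesis using f by (auto simp: PiE_def extensional_def)
        qed
      qed
      then show "f \<in> ?h ` ?TP" using T p by blast
    qed
  qed
  then have "(\<Sum>f\<in>?inj. F f) = (\<Sum>z\<in>?TP. F (?h z))"
    by (rule sum.reindex_bij_betw[symmetric])
  also have "\<dots> = (\<Sum>(T, p)\<in>?TP. F (\<lambda>i. en T ! p i))"
  proof (rule sum.cong[OF refl])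
    show "F (?h z) = (case z of (T, p) \<Rightarrow> F (\<lambda>i. en T ! p i))" for z
      by (cases z) (simp only: restr case_prod_conv)
  qed
  also have "\<dots> = (\<Sum>T | T \<subseteq> Q \<and> card T = n. \<Sum>p | p permutes ?I. F (\<lambda>i. en T ! p i))"
    by (rule sum.cartesian_product[symmetric])
  moreover have "(\<Sum>f \<in> PiE ?I (\<lambda>_. Q). F f) = (\<Sum>f\<in>?inj. F f)"
    using Q not_inj by (intro sum.mono_neutral_right) (auto simp: finite_PiE)
  ultimately show ?thesis by simp
qed

text \<open>Expand the determinant and the inner sums: every term chooses a map \<open>f\<close> from row positions to
  \<open>Q\<close>, and the sum over permutations for fixed \<open>f\<close> is a determinant of \<open>B\<close> along
  \<open>f\<close>. Sorting \<open>f\<close> into its image and a permutation, the sign of the permutation is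
  what is missing to make the product of entries of \<open>A\<close> a determinant too.\<close>

lemma Cauchy_Binet:
  assumes Q: "finite Q"
    and en: "\<And>T. T \<subseteq> Q \<Longrightarrow> distinct (en T) \<and> set (en T) = T"
    and "length is = n" "length js = n"
  shows "det_on is js (\<lambda>i j. \<Sum>q\<in>Q. A i q * B j q) =
    (\<Sum>T | T \<subseteq> Q \<and> card T = n. det_on is (en T) A * det_on js (en T) B)"
proof -
  let ?P = "{p. p permutes {0..<n}}"
  let ?Q = "PiE {0..<n} (\<lambda>_. Q)"
  define F where "F f = (\<Prod>i = 0..<n. A (is ! i) (f i)) * det_on js (map f [0..<n]) B" for f
  have len: "length (en T) = n" if "T \<subseteq> Q" "card T = n" for T
    using en[OF that(1)] that(2) distinct_card[of "en T"] by auto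
  have "det_on is js (\<lambda>i j. \<Sum>q\<in>Q. A i q * B j q) =
      (\<Sum>p\<in>?P. signof p * (\<Sum>f\<in>?Q. \<Prod>i = 0..<n. A (is ! i) (f i) * B (js ! p i) (f i)))"
    using assms by (simp add: det_on_expand[where n = n] prod_sum_PiE)
  also have "\<dots> = (\<Sum>f\<in>?Q. \<Sum>p\<in>?P. (\<Prod>i = 0..<n. A (is ! i) (f i)) *
      (signof p * (\<Prod>i = 0..<n. B (js ! p i) (f i))))"
    unfolding sum_distrib_left prod.distrib by (subst sum.swap) (simp add: mult_ac)
  also have "\<dots> = (\<Sum>f\<in>?Q. F f)"
  proof (rule sum.cong)
    fix f
    have "det_on js (map f [0..<n]) B = det_on (map f [0..<n]) js (\<lambda>q j. B j q)"
      using assms by (intro det_on_transpose[symmetric]) simp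
    then show "(\<Sum>p\<in>?P. (\<Prod>i = 0..<n. A (is ! i) (f i)) *
        (signof p * (\<Prod>i = 0..<n. B (js ! p i) (f i)))) = F f"
      using assms by (simp add: F_def det_on_expand[where n = n] sum_distrib_left)
  qed simp
  also have "\<dots> = (\<Sum>T | T \<subseteq> Q \<and> card T = n. \<Sum>p\<in>?P. F (\<lambda>i. en T ! p i))"
  proof (rule sum_maps_by_image[OF Q en])
    fix f :: "nat \<Rightarrow> 'a"
    have "map (restrict f {0..<n}) [0..<n] = map f [0..<n]"
      by (intro map_cong) auto
    moreover have "(\<Prod>i = 0..<n. A (is ! i) (restrict f {0..<n} i)) = (\<Prod>i = 0..<n. A (is ! i) (f i))"
      by (intro prod.cong) auto
    ultimately show "F (restrict f {0..<n}) = F f"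
      by (simp only: F_def)
    show "F f = 0" if "\<not> inj_on f {0..<n}"
      using that assms(4) by (simp add: F_def det_on_repeated_col distinct_map)
  qed auto
  also have "\<dots> = (\<Sum>T | T \<subseteq> Q \<and> card T = n. det_on is (en T) A * det_on js (en T) B)"
  proof (rule sum.cong[OF refl])
    fix T assume "T \<in> {T. T \<subseteq> Q \<and> card T = n}"
    then have T: "length (en T) = n" using len by auto
    then have "F (\<lambda>i. en T ! p i) =
        signof p * (\<Prod>i = 0..<n. A (is ! i) (en T ! p i)) * det_on js (en T) B"
      if "p \<in> ?P" for p
      using that by (simp add: F_def det_on_permute_cols[OF assms(4)])
    then show "(\<Sum>p\<in>?P. F (\<lambda>i. en T ! p i)) = det_on is (en T) A * det_on js (en T) B"
      unfolding det_on_expand[OF assms(3) T] sum_distrib_right by (intro sum.cong refl)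
  qed
  finally show ?thesis .
qed


text \<open>Expand both determinants; Fubini's theorem factors the integral of each term. For every
  permutation \<open>p\<close> in the first expansion, the sum over the second one is the determinant
  of the matrix of integrals with its rows permuted by \<open>p\<close>, and the two signs cancel, so that each
  of the \<open>n!\<close> permutations contributes the same.\<close>

lemma Andreief:
  fixes a b :: "'q \<Rightarrow> 'x \<Rightarrow> complex"
  assumes M: "sigma_finite_measure M" and ls: "length ls = n"
    and int: "\<And>k l. k \<in> set ls \<Longrightarrow> l \<in> set ls \<Longrightarrow> integrable M (\<lambda>t. a l t * b k t)"
  defines "D \<equiv> \<lambda>s. det_on (map s [0..<n]) ls (\<lambda>t l. a l t) * det_on (map s [0..<n]) ls (\<lambda>t l. b l t)"
  shows "integrable (Pi\<^sub>M {..<n} (\<lambda>_. M)) D"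
    and "(\<integral>s. D s \<partial>Pi\<^sub>M {..<n} (\<lambda>_. M)) =
      fact n * det_on ls ls (\<lambda>l k. \<integral>t. a l t * b k t \<partial>M)"
proof -
  interpret product_sigma_finite "\<lambda>_. M"
    using M by (simp add: product_sigma_finite_def)
  let ?P = "{p. p permutes {0..<n}}"
  let ?f = "\<lambda>p q i t. a (ls ! p i) t * b (ls ! q i) t"
  have D: "D s = (\<Sum>p\<in>?P. \<Sum>q\<in>?P. signof p * signof q * (\<Prod>i<n. ?f p q i (s i)))" for s
    using ls unfolding D_def
    by (simp add: det_on_expand[where n = n] sum_product prod.distrib mult_ac lessThan_atLeast0)
  have f_int: "integrable M (?f p q i)" if "p \<in> ?P" "q \<in> ?P" "i < n" for p q i
    using that ls permutes_in_image[of p "{0..<n}" i] permutes_in_image[of q "{0..<n}" i]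
    by (intro int) auto
  have prod_int: "integrable (Pi\<^sub>M {..<n} (\<lambda>_. M)) (\<lambda>s. \<Prod>i<n. ?f p q i (s i))"
    if "p \<in> ?P" "q \<in> ?P" for p q
    using f_int[OF that] by (intro product_integrable_prod) auto
  show "integrable (Pi\<^sub>M {..<n} (\<lambda>_. M)) D"
    unfolding D using prod_int
    by (intro Bochner_Integration.integrable_sum integrable_mult_right) auto
  let ?m = "\<lambda>l k. \<integral>t. a l t * b k t \<partial>M"
  have "(\<integral>s. D s \<partial>Pi\<^sub>M {..<n} (\<lambda>_. M)) =
      (\<Sum>p\<in>?P. \<Sum>q\<in>?P. signof p * signof q * (\<Prod>i<n. ?m (ls ! p i) (ls ! q i)))"
  proof -
    have "(\<integral>s. D s \<partial>Pi\<^sub>M {..<n} (\<lambda>_. M)) = (\<Sum>p\<in>?P. \<Sum>q\<in>?P.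
        \<integral>s. signof p * signof q * (\<Prod>i<n. ?f p q i (s i)) \<partial>Pi\<^sub>M {..<n} (\<lambda>_. M))"
      unfolding D using prod_int
      by (subst Bochner_Integration.integral_sum;
          (intro sum.cong refl Bochner_Integration.integral_sum)?;
          (intro Bochner_Integration.integrable_sum)?; intro integrable_mult_right) auto
    also have "\<dots> = (\<Sum>p\<in>?P. \<Sum>q\<in>?P. signof p * signof q * (\<Prod>i<n. ?m (ls ! p i) (ls ! q i)))"
    proof (intro sum.cong refl)
      fix p q assume "p \<in> ?P" "q \<in> ?P"
      then show "(\<integral>s. signof p * signof q * (\<Prod>i<n. ?f p q i (s i)) \<partial>Pi\<^sub>M {..<n} (\<lambda>_. M)) =
          signof p * signof q * (\<Prod>i<n. ?m (ls ! p i) (ls ! q i))"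
        using f_int[of p q] by (subst integral_mult_right_zero, subst product_integral_prod) auto
    qed
    finally show ?thesis .
  qed
  also have "\<dots> = (\<Sum>p\<in>?P. signof p * det_on (map (\<lambda>i. ls ! p i) [0..<n]) ls ?m)"
  proof (rule sum.cong[OF refl])
    fix p
    have "det_on (map (\<lambda>i. ls ! p i) [0..<n]) ls ?m =
        (\<Sum>q\<in>?P. signof q * (\<Prod>i<n. ?m (ls ! p i) (ls ! q i)))"
      using ls by (simp add: det_on_expand[where n = n] lessThan_atLeast0)
    then show "(\<Sum>q\<in>?P. signof p * signof q * (\<Prod>i<n. ?m (ls ! p i) (ls ! q i))) =
        signof p * det_on (map (\<lambda>i. ls ! p i) [0..<n]) ls ?m"
      by (simp only: sum_distrib_left mult.assoc)
  qed
  also have "\<dots> = (\<Sum>p\<in>?P. det_on ls ls ?m)"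
  proof (rule sum.cong[OF refl])
    fix p assume "p \<in> ?P"
    then have "signof p * det_on (map (\<lambda>i. ls ! p i) [0..<n]) ls ?m =
        signof p * (signof p * det_on ls ls ?m)"
      by (simp add: det_on_permute_rows[OF ls ls])
    then show "signof p * det_on (map (\<lambda>i. ls ! p i) [0..<n]) ls ?m = det_on ls ls ?m"
      by (cases "sign p = 1") (auto simp: sign_def)
  qed
  also have "\<dots> = fact n * det_on ls ls ?m"
    using card_permutations[of "{0..<n}" n] by simp
  finally show "(\<integral>s. D s \<partial>Pi\<^sub>M {..<n} (\<lambda>_. M)) = fact n * det_on ls ls ?m" .
qed

section \<open>Inner products and square integrable functions\<close>

lemma cinner_scaleC_right: "cinner u (a *\<^sub>C v) = cnj a * cinner u v"
  for u v :: "'e::complex_hilbert"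
  by (subst cinner_commute) (simp add: cinner_scaleC_left cinner_commute[of v u])

lemma cinner_add_right: "cinner u (v + w) = cinner u v + cinner u w"
  for u v w :: "'e::complex_hilbert"
  by (subst cinner_commute) (simp add: cinner_add_left cinner_commute[of v u] cinner_commute[of w u])

lemma cinner_self: "Re (cinner u u) = (norm u)\<^sup>2" for u :: "'e::complex_hilbert"
proof -
  have "0 \<le> Re (cinner u u)"
    using norm_ge_zero[of u] by (simp add: norm_eq_sqrt_cinner)
  then show ?thesis by (simp add: norm_eq_sqrt_cinner)
qed

lemma norm_scaleC: "norm (a *\<^sub>C u) = cmod a * norm u" for u :: "'e::complex_hilbert"
proof -
  have "(norm (a *\<^sub>C u))\<^sup>2 = Re ((a * cnj a) * cinner u u)"
    by (simp add: cinner_self[symmetric] cinner_scaleC_left cinner_scaleC_right mult_ac)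
  also have "\<dots> = (cmod a * norm u)\<^sup>2"
    by (simp add: complex_norm_square[symmetric] cinner_self power_mult_distrib del: of_real_power)
  finally show ?thesis by simp
qed

text \<open>The bound on the real part is the triangle inequality for \<open>w + v\<close>, squared; rotating \<open>u\<close> by
  the phase of the inner product reduces the modulus to the real part.\<close>

lemma Cauchy_Schwarz_cinner: "cmod (cinner u v) \<le> norm u * norm v"
  for u v :: "'e::complex_hilbert"
proof -
  have Re_le: "Re (cinner w v) \<le> norm w * norm v" for w
  proof -
    have "(norm (w + v))\<^sup>2 = (norm w)\<^sup>2 + 2 * Re (cinner w v) + (norm v)\<^sup>2"
      by (simp add: cinner_self[symmetric] cinner_add_left cinner_add_right cinner_commute[of v w])
    moreover have "(norm (w + v))\<^sup>2 \<le> (norm w + norm v)\<^sup>2"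
      by (intro power_mono norm_triangle_ineq) simp
    ultimately show ?thesis by (simp add: power2_sum)
  qed
  \<comment> \<open>Multiplication by this phase makes the inner product real and nonnegative.\<close>
  let ?c = "cnj (sgn (cinner u v))"
  have "cmod (cinner u v) = Re (cinner (?c *\<^sub>C u) v)"
  proof (cases "cinner u v = 0")
    case False
    have "cinner (?c *\<^sub>C u) v = cinner u v * cnj (cinner u v) / cmod (cinner u v)"
      by (simp add: cinner_scaleC_left sgn_div_norm divide_inverse scaleR_conv_of_real mult_ac)
    also have "\<dots> = cmod (cinner u v)"
      using False by (simp add: complex_norm_square[symmetric] power2_eq_square)
    finally show ?thesis by simp
  qed (simp add: cinner_scaleC_left)
  also have "\<dots> \<le> norm (?c *\<^sub>C u) * norm v" by (rule Re_le)
  also have "\<dots> \<le> 1 * norm u * norm v"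
    by (intro mult_right_mono) (auto simp: norm_scaleC norm_sgn)
  finally show ?thesis by simp
qed

lemma bounded_linear_scaleC_left:
  fixes v :: "'e::complex_hilbert"
  shows "bounded_linear (\<lambda>z. z *\<^sub>C v)"
  by (rule bounded_linear_intro[where K = "norm v"])
    (simp_all add: scaleC_add_left scaleR_scaleC[where ?'a = 'e] scaleC_scaleC norm_scaleC
      scaleR_conv_of_real)

lemma bounded_linear_cinner_left:
  fixes v :: "'e::complex_hilbert"
  shows "bounded_linear (\<lambda>u. cinner u v)"
  by (rule bounded_linear_intro[where K = "norm v"])
    (simp_all add: cinner_add_left scaleR_scaleC[where ?'a = 'e] cinner_scaleC_left
      Cauchy_Schwarz_cinner scaleR_conv_of_real)

lemma cinner_sum_left: "cinner (\<Sum>i\<in>I. f i) v = (\<Sum>i\<in>I. cinner (f i) v)"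
  for v :: "'e::complex_hilbert"
  using bounded_linear.linear[OF bounded_linear_cinner_left] by (rule linear_sum)

lemma cinner_sum_right: "cinner v (\<Sum>i\<in>I. f i) = (\<Sum>i\<in>I. cinner v (f i))"
  for v :: "'e::complex_hilbert"
  by (subst cinner_commute) (simp add: cinner_sum_left cinner_commute[of v])

lemma L2_bounded_linear:
  fixes T :: "'d::complex_hilbert \<Rightarrow> 'e::complex_hilbert"
  assumes T: "bounded_linear T" and f: "f \<in> L2"
  shows "(\<lambda>s. T (f s)) \<in> L2"
proof -
  obtain K where K: "\<And>u. norm (T u) \<le> norm u * K"
    using bounded_linear.bounded[OF T] by blast
  have T_meas: "T \<in> borel_measurable borel"
    by (intro borel_measurable_continuous_onI linear_continuous_on T)
  have meas: "(\<lambda>s. T (f s)) \<in> borel_measurable half_line"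
    using f T_meas by (auto simp: L2_def intro: measurable_compose)
  have "integrable half_line (\<lambda>s. K\<^sup>2 * (norm (f s))\<^sup>2)"
    using f by (simp add: L2_def)
  then have "integrable half_line (\<lambda>s. (norm (T (f s)))\<^sup>2)"
  proof (rule Bochner_Integration.integrable_bound)
    show "(\<lambda>s. (norm (T (f s)))\<^sup>2) \<in> borel_measurable half_line"
      using meas by measurable
    show "AE s in half_line. norm ((norm (T (f s)))\<^sup>2) \<le> norm (K\<^sup>2 * (norm (f s))\<^sup>2)"
    proof (intro AE_I2)
      fix s
      have "(norm (T (f s)))\<^sup>2 \<le> (norm (f s) * K)\<^sup>2"
        by (intro power_mono K) simp
      then show "norm ((norm (T (f s)))\<^sup>2) \<le> norm (K\<^sup>2 * (norm (f s))\<^sup>2)"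
        by (simp add: power_mult_distrib mult.commute)
    qed
  qed
  then show ?thesis using meas by (simp add: L2_def)
qed

lemma L2_add:
  fixes f g :: "real \<Rightarrow> 'e::complex_hilbert"
  assumes f: "f \<in> L2" and g: "g \<in> L2"
  shows "(\<lambda>s. f s + g s) \<in> L2"
proof -
  have meas [measurable]: "f \<in> borel_measurable half_line" "g \<in> borel_measurable half_line"
    using f g by (auto simp: L2_def)
  have "integrable half_line (\<lambda>s. 2 * (norm (f s))\<^sup>2 + 2 * (norm (g s))\<^sup>2)"
    using f g by (simp add: L2_def)
  then have "integrable half_line (\<lambda>s. (norm (f s + g s))\<^sup>2)"
  proof (rule Bochner_Integration.integrable_bound)
    show "(\<lambda>s. (norm (f s + g s))\<^sup>2) \<in> borel_measurable half_line" by measurable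
    show "AE s in half_line. norm ((norm (f s + g s))\<^sup>2) \<le>
        norm (2 * (norm (f s))\<^sup>2 + 2 * (norm (g s))\<^sup>2)"
    proof (intro AE_I2)
      fix s
      have "(norm (f s + g s))\<^sup>2 \<le> (norm (f s) + norm (g s))\<^sup>2"
        by (intro power_mono norm_triangle_ineq) simp
      also have "\<dots> \<le> 2 * (norm (f s))\<^sup>2 + 2 * (norm (g s))\<^sup>2"
        using zero_le_power2[of "norm (f s) - norm (g s)"]
        by (simp add: power2_sum power2_diff)
      finally show "norm ((norm (f s + g s))\<^sup>2) \<le>
        norm (2 * (norm (f s))\<^sup>2 + 2 * (norm (g s))\<^sup>2)" by simp
    qed
  qed
  then show ?thesis by (simp add: L2_def)
qed

lemma L2_sum:
  fixes f :: "'i \<Rightarrow> real \<Rightarrow> 'e::complex_hilbert"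
  assumes "\<And>i. i \<in> I \<Longrightarrow> f i \<in> L2"
  shows "(\<lambda>s. \<Sum>i\<in>I. f i s) \<in> L2"
proof -
  have zero: "(\<lambda>s. 0 :: 'e) \<in> L2" by (simp add: L2_def)
  show ?thesis
    using assms
  proof (induction I rule: infinite_finite_induct)
    case (insert i I)
    then show ?case using L2_add[of "f i" "\<lambda>s. \<Sum>i\<in>I. f i s"] by simp
  qed (simp_all add: zero)
qed

lemma L2_mult_integrable:
  assumes f: "f \<in> L2" and g: "g \<in> L2"
  shows "integrable half_line (\<lambda>s. f s * g s :: complex)"
proof -
  have meas [measurable]: "f \<in> borel_measurable half_line" "g \<in> borel_measurable half_line"
    using f g by (auto simp: L2_def)
  have "integrable half_line (\<lambda>s. (norm (f s))\<^sup>2 + (norm (g s))\<^sup>2)"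
    using f g by (simp add: L2_def)
  then show ?thesis
  proof (rule Bochner_Integration.integrable_bound)
    show "AE s in half_line. norm (f s * g s) \<le> norm ((norm (f s))\<^sup>2 + (norm (g s))\<^sup>2)"
    proof (intro AE_I2)
      fix s
      have "0 \<le> (norm (f s) - norm (g s))\<^sup>2" "0 \<le> norm (f s) * norm (g s)" by simp_all
      then show "norm (f s * g s) \<le> norm ((norm (f s))\<^sup>2 + (norm (g s))\<^sup>2)"
        unfolding power2_diff by (simp add: norm_mult; linarith)
    qed
  qed measurable
qed

lemma L2_cnj: "f \<in> L2 \<Longrightarrow> (\<lambda>s. cnj (f s)) \<in> L2"
  by (rule L2_bounded_linear[OF bounded_linear_cnj])

text \<open>Any concrete map with the adjoint property represents the adjoint: two candidates \<open>B\<close> and \<open>B'\<close>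
  have the same inner products with every square integrable function, in particular with
  \<open>B' g - B g\<close>, so that this difference has norm zero.\<close>

lemma L2_adjoint_AE:
  fixes A :: "(real \<Rightarrow> complex) \<Rightarrow> (real \<Rightarrow> 'e::complex_hilbert)"
  assumes B_L2: "\<And>g. g \<in> L2 \<Longrightarrow> B g \<in> L2"
    and adj: "\<And>h g. h \<in> L2 \<Longrightarrow> g \<in> L2 \<Longrightarrow> L2_inner (A h) g = L2_inner h (B g)"
    and g: "g \<in> L2"
  shows "AE t in half_line. L2_adjoint A g t = B g t"
proof -
  define B' where "B' = L2_adjoint A"
  have "\<exists>B. (\<forall>g\<in>L2. B g \<in> L2) \<and> (\<forall>h\<in>L2. \<forall>g\<in>L2. L2_inner (A h) g = L2_inner h (B g))"
    using B_L2 adj by blast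
  then have B': "(\<forall>g\<in>L2. B' g \<in> L2) \<and>
      (\<forall>h\<in>L2. \<forall>g\<in>L2. L2_inner (A h) g = L2_inner h (B' g))"
    unfolding B'_def L2_adjoint_def by (rule someI_ex)
  define w where "w t = B' g t - B g t" for t
  have w: "w \<in> L2"
  proof -
    have "(\<lambda>t. - B g t) \<in> L2"
      using bounded_linear_minus[OF bounded_linear_ident] B_L2[OF g] by (rule L2_bounded_linear)
    then have "(\<lambda>t. B' g t + - B g t) \<in> L2"
      using B' g by (intro L2_add) auto
    then show ?thesis by (simp add: w_def[abs_def])
  qed
  have int: "integrable half_line (\<lambda>t. w t * cnj (B' g t))"
    "integrable half_line (\<lambda>t. w t * cnj (B g t))"
    using B' B_L2 g by (auto intro!: L2_mult_integrable[OF w] L2_cnj)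
  have "L2_inner w (B' g) = L2_inner w (B g)"
    using B' adj w g by metis
  then have "0 = (\<integral>t. w t * cnj (B' g t) - w t * cnj (B g t) \<partial>half_line)"
    using int by (simp add: L2_inner_def cinner_complex_def)
  also have "\<dots> = (\<integral>t. complex_of_real ((norm (w t))\<^sup>2) \<partial>half_line)"
    by (rule Bochner_Integration.integral_cong)
      (simp_all only: complex_norm_square, simp add: w_def algebra_simps)
  also have "\<dots> = complex_of_real (\<integral>t. (norm (w t))\<^sup>2 \<partial>half_line)"
    by (rule integral_complex_of_real)
  finally have "(\<integral>t. (norm (w t))\<^sup>2 \<partial>half_line) = 0" by simp
  then have "AE t in half_line. (norm (w t))\<^sup>2 = 0"
    using w by (subst (asm) integral_nonneg_eq_0_iff_AE) (auto simp: L2_def)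
  then show ?thesis by (simp add: w_def B'_def)
qed

section \<open>Exponentials on the half line\<close>

lemma exp_half_line:
  assumes "0 < Re \<mu>"
  shows "integrable half_line (\<lambda>s. exp (- \<mu> * complex_of_real s))"
    and "(\<integral>s. exp (- \<mu> * complex_of_real s) \<partial>half_line) = 1 / \<mu>"
proof -
  let ?e = "\<lambda>s. exp (- \<mu> * complex_of_real s)"
  have "set_integrable lborel {0<..} (\<lambda>s. exp (- (s * Re \<mu>)))"
    using assms by (rule integrable_I0i_exp_mscale)
  then have set_int: "set_integrable lborel {0<..} ?e"
    by (rule set_integrable_bound) (auto simp: set_borel_measurable_def mult.commute)
  then show "integrable half_line ?e"
    by (simp add: integrable_restrict_space set_integrable_def)
  let ?F = "\<lambda>s. - ?e s / \<mu>"
  have mu: "\<mu> \<noteq> 0" using assms by auto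
  have "(LBINT s=0..\<infinity>. ?e s) = 0 - (- 1 / \<mu>)"
  proof (rule interval_integral_FTC_integrable)
    show "(?F has_vector_derivative ?e s) (at s)" for s
      using mu by (intro has_vector_derivative_real_field) (auto intro!: derivative_eq_intros)
    show "set_integrable lborel (einterval 0 \<infinity>) ?e"
      using set_int by (simp add: einterval_def zero_ereal_def greaterThan_def)
    have "(?F \<longlongrightarrow> ?F 0) (at_right 0)"
      using mu by (intro tendsto_intros) auto
    then show "((?F \<circ> real_of_ereal) \<longlongrightarrow> - 1 / \<mu>) (at_right 0)"
      unfolding zero_ereal_def ereal_tendsto_simps by simp
    have "((\<lambda>s. exp (- (Re \<mu> * s)) / cmod \<mu>) \<longlongrightarrow> 0) at_top"
      using assms by (intro tendsto_divide_zero filterlim_compose[OF exp_at_bot]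
          filterlim_compose[OF filterlim_uminus_at_bot_at_top]
          filterlim_tendsto_pos_mult_at_top[OF tendsto_const _ filterlim_ident])
    then have "(?F \<longlongrightarrow> 0) at_top"
      by (subst tendsto_norm_zero_iff[symmetric]) (simp add: norm_divide)
    then show "((?F \<circ> real_of_ereal) \<longlongrightarrow> 0) (at_left \<infinity>)"
      unfolding ereal_tendsto_simps .
  qed (auto intro!: continuous_intros)
  then show "(\<integral>s. ?e s \<partial>half_line) = 1 / \<mu>"
    by (simp add: interval_lebesgue_integral_0_infty integral_restrict_space
        set_lebesgue_integral_def)
qed

lemma L2_exp:
  assumes "0 < Re \<mu>"
  shows "(\<lambda>s. exp (- \<mu> * complex_of_real s)) \<in> L2"
proof -
  have "integrable half_line (\<lambda>s. norm (exp (- (2 * \<mu>) * complex_of_real s)))"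
    using assms by (intro integrable_norm exp_half_line) simp
  moreover have "(\<lambda>s. exp (- \<mu> * complex_of_real s)) \<in> borel_measurable half_line"
    by (intro measurable_restrict_space1) measurable
  ultimately show ?thesis
    by (simp add: L2_def exp_double[symmetric] mult.assoc)
qed

definition laplace :: "(real \<Rightarrow> complex) \<Rightarrow> complex \<Rightarrow> complex"
  where "laplace h \<mu> = (\<integral>t. h t * exp (- \<mu> * complex_of_real t) \<partial>half_line)"

lemma laplace_exp:
  assumes "0 < Re \<mu>" "0 < Re \<kappa>"
  shows "laplace (\<lambda>t. exp (- \<kappa> * complex_of_real t)) \<mu> = 1 / (\<kappa> + \<mu>)"
  using exp_half_line(2)[of "\<kappa> + \<mu>"] assms
  by (simp add: laplace_def exp_add[symmetric] algebra_simps)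

lemma laplace_integrable:
  "h \<in> L2 \<Longrightarrow> 0 < Re \<mu> \<Longrightarrow> integrable half_line (\<lambda>t. h t * exp (- \<mu> * complex_of_real t))"
  by (intro L2_mult_integrable L2_exp)

lemma laplace_sum:
  assumes "0 < Re \<mu>" "\<And>j. j \<in> J \<Longrightarrow> h j \<in> L2"
  shows "laplace (\<lambda>t. \<Sum>j\<in>J. c j * h j t) \<mu> = (\<Sum>j\<in>J. c j * laplace (h j) \<mu>)"
  using laplace_integrable[OF _ assms(1)] assms(2) unfolding laplace_def
  by (simp add: sum_distrib_right mult.assoc Bochner_Integration.integral_sum)

section \<open>Hankel operators with exponential symbols\<close>

text \<open>The exponential of a sum separates, and the integral over \<open>t\<close> leaves a Laplace transform.\<close>

lemma hankel_exp_symbol: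
  fixes v :: "nat \<Rightarrow> 'e::complex_hilbert"
  assumes lam: "\<And>j. j \<in> {1..N} \<Longrightarrow> 0 < Re (lam j)" and h: "h \<in> L2"
  shows "hankel (exp_symbol N lam v) h s =
    (\<Sum>j = 1..N. (laplace h (cnj (lam j)) * exp (- cnj (lam j) * complex_of_real s)) *\<^sub>C v j)"
proof -
  let ?e = "\<lambda>j t. exp (- cnj (lam j) * complex_of_real t)"
  have e_int: "integrable half_line (\<lambda>t. h t * ?e j t)" if "j \<in> {1..N}" for j
    using lam[OF that] by (intro laplace_integrable h) simp
  have term_int: "integrable half_line (\<lambda>t. (h t * ?e j t * ?e j s) *\<^sub>C v j)"
    and term_val: "(\<integral>t. (h t * ?e j t * ?e j s) *\<^sub>C v j \<partial>half_line) =
      (laplace h (cnj (lam j)) * ?e j s) *\<^sub>C v j" if "j \<in> {1..N}" for j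
  proof -
    have int: "integrable half_line (\<lambda>t. h t * ?e j t * ?e j s)"
      by (intro integrable_mult_left e_int that)
    show "integrable half_line (\<lambda>t. (h t * ?e j t * ?e j s) *\<^sub>C v j)"
      by (rule integrable_bounded_linear[OF bounded_linear_scaleC_left int])
    show "(\<integral>t. (h t * ?e j t * ?e j s) *\<^sub>C v j \<partial>half_line) =
      (laplace h (cnj (lam j)) * ?e j s) *\<^sub>C v j"
      unfolding integral_bounded_linear[OF bounded_linear_scaleC_left int]
      by (simp add: laplace_def)
  qed
  have add: "a *\<^sub>C sum f J = (\<Sum>j\<in>J. a *\<^sub>C f j)" for a and f :: "nat \<Rightarrow> 'e" and J
  proof (rule linear_sum)
    show "linear (\<lambda>u :: 'e. a *\<^sub>C u)"
      by (rule linearI) (simp_all add: scaleC_add_right scaleR_scaleC scaleC_scaleC mult.commute)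
  qed
  have "hankel (exp_symbol N lam v) h s =
      (\<integral>t. (\<Sum>j = 1..N. (h t * ?e j t * ?e j s) *\<^sub>C v j) \<partial>half_line)"
    unfolding hankel_def exp_symbol_def add
    by (simp add: scaleC_scaleC exp_add[symmetric] algebra_simps)
  then show ?thesis
    using term_int term_val by (simp add: Bochner_Integration.integral_sum)
qed

lemma L2_hankel_exp_symbol:
  fixes v :: "nat \<Rightarrow> 'e::complex_hilbert"
  assumes lam: "\<And>j. j \<in> {1..N} \<Longrightarrow> 0 < Re (lam j)" and h: "h \<in> L2"
  shows "hankel (exp_symbol N lam v) h \<in> L2"
proof -
  have "(\<lambda>s. (laplace h (cnj (lam j)) * exp (- cnj (lam j) * complex_of_real s)) *\<^sub>C v j) \<in> L2"
    if "j \<in> {1..N}" for j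
    using lam[OF that]
    by (intro L2_bounded_linear[OF bounded_linear_scaleC_left]
        L2_bounded_linear[OF bounded_linear_mult_right] L2_exp) simp
  then have "(\<lambda>s. \<Sum>j = 1..N. (laplace h (cnj (lam j)) *
      exp (- cnj (lam j) * complex_of_real s)) *\<^sub>C v j) \<in> L2"
    by (rule L2_sum)
  moreover have "hankel (exp_symbol N lam v) h = (\<lambda>s. \<Sum>j = 1..N. (laplace h (cnj (lam j)) *
      exp (- cnj (lam j) * complex_of_real s)) *\<^sub>C v j)"
    using hankel_exp_symbol lam h by blast
  ultimately show ?thesis by simp
qed

text \<open>Since the image of the Hankel operator lies in a finite-dimensional space, the adjoint
  identity is an equality of finite sums of products of integrals.\<close>

lemma hankel_exp_symbol_adjoint:
  fixes v :: "nat \<Rightarrow> 'e::complex_hilbert"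
  assumes lam: "\<And>j. j \<in> {1..N} \<Longrightarrow> 0 < Re (lam j)" and g: "g \<in> L2"
  shows "AE t in half_line. L2_adjoint (hankel (exp_symbol N lam v)) g t =
    (\<Sum>k = 1..N. laplace (\<lambda>s. cinner (g s) (v k)) (lam k) * exp (- lam k * complex_of_real t))"
proof (rule L2_adjoint_AE[where g = g and B = "\<lambda>g t. \<Sum>k = 1..N.
      laplace (\<lambda>s. cinner (g s) (v k)) (lam k) * exp (- lam k * complex_of_real t)"])
  show "(\<lambda>t. \<Sum>k = 1..N. laplace (\<lambda>s. cinner (g s) (v k)) (lam k) *
      exp (- lam k * complex_of_real t)) \<in> L2" for g :: "real \<Rightarrow> 'e"
    using lam by (intro L2_sum L2_bounded_linear[OF bounded_linear_mult_right] L2_exp)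
next
  fix h :: "real \<Rightarrow> complex" and g :: "real \<Rightarrow> 'e"
  assume h: "h \<in> L2" and g: "g \<in> L2"
  let ?c = "\<lambda>j. laplace h (cnj (lam j))"
  let ?d = "\<lambda>k. laplace (\<lambda>s. cinner (g s) (v k)) (lam k)"
  have gv: "integrable half_line (\<lambda>s. cinner (g s) (v j) * exp (- lam j * complex_of_real s))"
    if "j \<in> {1..N}" for j
    using lam[OF that] by (intro laplace_integrable L2_bounded_linear[OF bounded_linear_cinner_left] g)
  have hankel: "hankel (exp_symbol N lam v) h s =
      (\<Sum>j = 1..N. (?c j * exp (- cnj (lam j) * complex_of_real s)) *\<^sub>C v j)" for s
    using lam h by (rule hankel_exp_symbol)
  have "L2_inner (hankel (exp_symbol N lam v) h) g =
      (\<integral>s. (\<Sum>j = 1..N. ?c j * cnj (cinner (g s) (v j) * exp (- lam j * complex_of_real s))) \<partial>half_line)"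
    unfolding L2_inner_def hankel cinner_sum_left cinner_scaleC_left
    by (simp add: exp_cnj cinner_commute[of "v _"] mult_ac)
  also have "\<dots> = (\<Sum>j = 1..N. ?c j * cnj (?d j))"
    using gv unfolding laplace_def
    by (subst Bochner_Integration.integral_sum) (auto simp del: complex_cnj_mult)
  also have "\<dots> = (\<integral>t. (\<Sum>j = 1..N. h t * exp (- cnj (lam j) * complex_of_real t) * cnj (?d j)) \<partial>half_line)"
    using laplace_integrable[OF h] lam unfolding laplace_def[of h]
    by (subst Bochner_Integration.integral_sum) auto
  also have "\<dots> = L2_inner h (\<lambda>t. \<Sum>k = 1..N. ?d k * exp (- lam k * complex_of_real t))"
    by (simp add: L2_inner_def cinner_complex_def exp_cnj sum_distrib_left mult_ac)
  finally show "L2_inner (hankel (exp_symbol N lam v) h) g =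
    L2_inner h (\<lambda>t. \<Sum>k = 1..N. ?d k * exp (- lam k * complex_of_real t))" .
qed (rule g)

text \<open>The factor \<open>1 / (lam k + cnj (lam j))\<close> comes from composing the two operators: it is the integral
  over the half line of \<open>exp (- lam k * s) * exp (- cnj (lam j) * s)\<close>.\<close>

lemma kernel_of_hankel_square:
  fixes v :: "nat \<Rightarrow> 'e::complex_hilbert"
  assumes lam: "\<And>j. j \<in> {1..N} \<Longrightarrow> 0 < Re (lam j)"
  shows "kernel_of (hankel_square (exp_symbol N lam v)) (\<lambda>s t. \<Sum>k = 1..N.
    exp (- lam k * complex_of_real s) *
      (\<Sum>j = 1..N. cinner (v j) (v k) / (lam k + cnj (lam j)) * exp (- cnj (lam j) * complex_of_real t)))"
  unfolding kernel_of_def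
proof
  fix h :: "real \<Rightarrow> complex" assume h: "h \<in> L2"
  let ?G = "hankel (exp_symbol N lam v) h"
  let ?e = "\<lambda>j t. exp (- cnj (lam j) * complex_of_real t)"
  have hankel: "?G s = (\<Sum>j = 1..N. (laplace h (cnj (lam j)) * ?e j s) *\<^sub>C v j)" for s
    using lam h by (rule hankel_exp_symbol)
  have e_int: "integrable half_line (\<lambda>t. ?e j t * h t)" if "j \<in> {1..N}" for j
    using laplace_integrable[OF h, of "cnj (lam j)"] lam[OF that] by (simp add: mult.commute)
  have e_L2: "?e j \<in> L2" if "j \<in> {1..N}" for j
    using lam[OF that] by (intro L2_exp) simp
  have adjoint: "AE s in half_line. L2_adjoint (hankel (exp_symbol N lam v)) ?G s =
      (\<Sum>k = 1..N. laplace (\<lambda>s. cinner (?G s) (v k)) (lam k) * exp (- lam k * complex_of_real s))"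
    using lam h by (intro hankel_exp_symbol_adjoint L2_hankel_exp_symbol)
  have coeff: "laplace (\<lambda>s. cinner (?G s) (v k)) (lam k) =
      (\<integral>t. (\<Sum>j = 1..N. cinner (v j) (v k) / (lam k + cnj (lam j)) * (?e j t * h t)) \<partial>half_line)"
    if k: "k \<in> {1..N}" for k
  proof -
    have "laplace (\<lambda>s. cinner (?G s) (v k)) (lam k) =
        laplace (\<lambda>s. \<Sum>j = 1..N. (laplace h (cnj (lam j)) * cinner (v j) (v k)) * ?e j s) (lam k)"
      unfolding hankel cinner_sum_left cinner_scaleC_left
      by (simp add: mult_ac)
    also have "\<dots> = (\<Sum>j = 1..N. (laplace h (cnj (lam j)) * cinner (v j) (v k)) * laplace (?e j) (lam k))"
      using lam[OF k] e_L2 by (rule laplace_sum)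
    also have "\<dots> = (\<Sum>j = 1..N. cinner (v j) (v k) / (lam k + cnj (lam j)) *
        (\<integral>t. ?e j t * h t \<partial>half_line))"
    proof (rule sum.cong[OF refl])
      fix j assume j: "j \<in> {1..N}"
      have "laplace (?e j) (lam k) = 1 / (cnj (lam j) + lam k)"
        using lam[OF k] lam[OF j] by (intro laplace_exp) simp_all
      then show "(laplace h (cnj (lam j)) * cinner (v j) (v k)) * laplace (?e j) (lam k) =
          cinner (v j) (v k) / (lam k + cnj (lam j)) * (\<integral>t. ?e j t * h t \<partial>half_line)"
        by (simp add: laplace_def mult_ac add.commute)
    qed
    also have "\<dots> = (\<integral>t. (\<Sum>j = 1..N. cinner (v j) (v k) / (lam k + cnj (lam j)) * (?e j t * h t)) \<partial>half_line)"
      using e_int by (subst Bochner_Integration.integral_sum) auto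
    finally show ?thesis .
  qed
  show "AE s in half_line.
      integrable half_line (\<lambda>t. (\<Sum>k = 1..N. exp (- lam k * complex_of_real s) *
        (\<Sum>j = 1..N. cinner (v j) (v k) / (lam k + cnj (lam j)) * ?e j t)) * h t) \<and>
      hankel_square (exp_symbol N lam v) h s =
        (\<integral>t. (\<Sum>k = 1..N. exp (- lam k * complex_of_real s) *
          (\<Sum>j = 1..N. cinner (v j) (v k) / (lam k + cnj (lam j)) * ?e j t)) * h t \<partial>half_line)"
    using adjoint
  proof eventually_elim
    case (elim s)
    let ?b = "\<lambda>k t. \<Sum>j = 1..N. cinner (v j) (v k) / (lam k + cnj (lam j)) * (?e j t * h t)"
    have b_int: "integrable half_line (?b k)" for k
      using e_int by (intro Bochner_Integration.integrable_sum integrable_mult_right) auto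
    have kernel: "(\<Sum>k = 1..N. exp (- lam k * complex_of_real s) *
          (\<Sum>j = 1..N. cinner (v j) (v k) / (lam k + cnj (lam j)) * ?e j t)) * h t =
        (\<Sum>k = 1..N. exp (- lam k * complex_of_real s) * ?b k t)" for t
      by (simp add: sum_distrib_right mult.assoc)
    have "hankel_square (exp_symbol N lam v) h s =
        (\<Sum>k = 1..N. exp (- lam k * complex_of_real s) * (\<integral>t. ?b k t \<partial>half_line))"
      using elim by (simp add: hankel_square_def coeff mult.commute)
    also have "\<dots> = (\<integral>t. (\<Sum>k = 1..N. exp (- lam k * complex_of_real s) * ?b k t) \<partial>half_line)"
      using b_int by (simp add: Bochner_Integration.integral_sum)
    finally show ?case
      unfolding kernel using b_int by auto
  qed
qed

section \<open>Fredholm determinants of finite-rank kernels\<close>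

text \<open>If two continuous kernels differ at \<open>(s, t)\<close>, then after normalising the difference to \<open>1\<close> at
  that point its real part is at least \<open>1/2\<close> on a small square around it. Applied to the
  indicator function of the side of the square around \<open>t\<close>, the two operators then differ on a whole
  interval around \<open>s\<close>, which is not a null set.\<close>

lemma kernel_of_unique:
  assumes k1: "kernel_of K k1" "continuous_on ({0<..} \<times> {0<..}) (\<lambda>(s, t). k1 s t)"
    and k2: "kernel_of K k2" "continuous_on ({0<..} \<times> {0<..}) (\<lambda>(s, t). k2 s t)"
    and pos: "0 < s" "0 < t"
  shows "k1 s t = k2 s t"
proof (rule ccontr)
  assume neq: "k1 s t \<noteq> k2 s t"
  let ?Q = "{0<..} \<times> {0<..} :: (real \<times> real) set"
  define d where "d = (\<lambda>p. (k1 (fst p) (snd p) - k2 (fst p) (snd p)) / (k1 s t - k2 s t))"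
  have d_cont: "continuous_on ?Q d"
    using continuous_on_diff[OF k1(2) k2(2)] neq unfolding d_def
    by (intro continuous_on_divide continuous_on_const) (auto simp: case_prod_unfold)
  have "d (s, t) = 1" using neq by (simp add: d_def)
  moreover have "(d \<longlongrightarrow> d (s, t)) (at (s, t) within ?Q)"
    using d_cont pos by (auto simp: continuous_on_def)
  ultimately have "(d \<longlongrightarrow> 1) (at (s, t) within ?Q)" by simp
  then have "eventually (\<lambda>p. dist (d p) 1 < 1 / 2) (at (s, t) within ?Q)"
    by (rule tendstoD) simp
  then obtain \<delta> where \<delta>: "0 < \<delta>"
    "\<And>p. p \<in> ?Q \<Longrightarrow> p \<noteq> (s, t) \<Longrightarrow> dist p (s, t) < \<delta> \<Longrightarrow> dist (d p) 1 < 1 / 2"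
    unfolding eventually_at by blast
  \<comment> \<open>The square of half side \<open>\<eta>\<close> lies in the open quadrant and in the \<open>\<delta>\<close>-ball.\<close>
  define \<eta> where "\<eta> = min (\<delta> / 2) (min (s / 2) (t / 2))"
  have \<eta>: "0 < \<eta>" "\<eta> < s" "\<eta> < t" "2 * \<eta> \<le> \<delta>"
    using \<delta>(1) pos by (auto simp: \<eta>_def)
  have close: "1 / 2 \<le> Re (d (s', t'))"
    if "s' \<in> {s - \<eta><..<s + \<eta>}" "t' \<in> {t - \<eta><..<t + \<eta>}" for s' t'
  proof (cases "(s', t') = (s, t)")
    case True
    then show ?thesis using \<open>d (s, t) = 1\<close> by simp
  next
    case False
    have "dist (s', t') (s, t) \<le> dist s' s + dist t' t"
      by (simp add: dist_Pair_Pair sqrt_sum_squares_le_sum)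
    also have "\<dots> < \<delta>" using that \<eta>(4) by (auto simp: dist_real_def)
    finally have "dist (d (s', t')) 1 < 1 / 2"
      using that \<eta> False by (intro \<delta>(2)) auto
    then have "\<bar>Re (d (s', t')) - 1\<bar> < 1 / 2"
      using abs_Re_le_cmod[of "d (s', t') - 1"] by (simp add: dist_norm)
    then show ?thesis by linarith
  qed
  let ?J = "{t - \<eta><..<t + \<eta>}"
  let ?h = "\<lambda>u. complex_of_real (indicator ?J u)"
  have J: "?J \<subseteq> {0<..}" using \<eta> by auto
  have J_int: "integrable half_line (\<lambda>u. indicator ?J u :: real)"
    using J \<eta> by (simp add: integrable_restrict_space indicator_inter_arith[symmetric] Int_absorb1)
  have J_val: "(\<integral>u. indicator ?J u \<partial>half_line) = 2 * \<eta>"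
    using J \<eta> by (simp add: measure_restrict_space Int_absorb2)
  have "(norm (?h u))\<^sup>2 = indicator ?J u" for u
    by (simp add: indicator_def)
  moreover have "?h \<in> borel_measurable half_line"
    by (intro measurable_restrict_space1) measurable
  ultimately have h: "?h \<in> L2" using J_int by (simp add: L2_def)
  have "AE s' in half_line. s' \<notin> {s - \<eta><..<s + \<eta>}"
    using k1(1)[unfolded kernel_of_def, rule_format, OF h]
      k2(1)[unfolded kernel_of_def, rule_format, OF h]
  proof eventually_elim
    case (elim s')
    show ?case
    proof
      assume s': "s' \<in> {s - \<eta><..<s + \<eta>}"
      have int: "integrable half_line (\<lambda>u. d (s', u) * ?h u)"
        using elim unfolding d_def
        by (simp add: left_diff_distrib diff_divide_distrib)
      have "(\<integral>u. d (s', u) * ?h u \<partial>half_line) = 0"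
        using elim unfolding d_def
        by (simp add: left_diff_distrib diff_divide_distrib)
      then have "(\<integral>u. Re (d (s', u) * ?h u) \<partial>half_line) = 0"
        using integral_Re[OF int] by (simp only: zero_complex.sel)
      moreover have "(\<integral>u. 1 / 2 * indicator ?J u \<partial>half_line) \<le> (\<integral>u. Re (d (s', u) * ?h u) \<partial>half_line)"
      proof (rule integral_mono)
        show "integrable half_line (\<lambda>u. 1 / 2 * indicator ?J u :: real)"
          using J_int by (rule integrable_mult_right)
        show "integrable half_line (\<lambda>u. Re (d (s', u) * ?h u))"
          using int by (rule integrable_Re)
        show "1 / 2 * indicator ?J u \<le> Re (d (s', u) * ?h u)" for u
          using close[OF s', of u] by (cases "u \<in> ?J") auto
      qed
      ultimately show False using J_val \<eta>(1) by simp
    qed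
  qed
  then have "AE s' in lborel. s' \<notin> {s - \<eta><..<s + \<eta>}"
    using \<eta> by (subst (asm) AE_restrict_space_iff) (auto elim: eventually_mono)
  then have "emeasure lborel {s - \<eta><..<s + \<eta>} = 0"
    by (subst (asm) AE_iff_measurable[where N = "{s - \<eta><..<s + \<eta>}"]) auto
  then show False using \<eta>(1) by simp
qed

text \<open>The coordinates of a point of the product space are positive, so only the values of the kernel on
  the open quadrant matter.\<close>

lemma fredholm_minor_cong:
  assumes "\<And>s t. 0 < s \<Longrightarrow> 0 < t \<Longrightarrow> k1 s t = k2 s t"
    and "s \<in> space (\<Pi>\<^sub>M i\<in>{..<n}. half_line)"
  shows "fredholm_minor k1 n s = fredholm_minor k2 n s"
proof -
  have "0 < s i" if "i < n" for i
    using assms(2) that by (auto simp: space_PiM space_restrict_space PiE_def)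
  then show ?thesis
    unfolding fredholm_minor_def using assms(1)
    by (intro arg_cong[where f = Determinant.det] Matrix.eq_matI) auto
qed

lemma fredholm_det_eqI:
  assumes cont: "continuous_on ({0<..} \<times> {0<..}) (\<lambda>(s, t). k s t)" and K: "kernel_of K k"
    and int: "\<And>n. integrable (\<Pi>\<^sub>M i\<in>{..<n}. half_line) (fredholm_minor k n)"
    and sums: "(\<lambda>n. (- 1) ^ n / fact n *
      (\<integral>s. fredholm_minor k n s \<partial>(\<Pi>\<^sub>M i\<in>{..<n}. half_line))) sums d"
  shows "fredholm_det K = d"
  unfolding fredholm_det_def
proof (rule the_equality)
  fix d'
  assume "\<exists>k. continuous_on ({0<..} \<times> {0<..}) (\<lambda>(s, t). k s t) \<and> kernel_of K k \<and>
    (\<forall>n. integrable (\<Pi>\<^sub>M i\<in>{..<n}. half_line) (fredholm_minor k n)) \<and>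
    (\<lambda>n. (- 1) ^ n / fact n * (\<integral>s. fredholm_minor k n s \<partial>(\<Pi>\<^sub>M i\<in>{..<n}. half_line))) sums d'"
  then obtain k' where cont': "continuous_on ({0<..} \<times> {0<..}) (\<lambda>(s, t). k' s t)"
    and K': "kernel_of K k'"
    and sums': "(\<lambda>n. (- 1) ^ n / fact n *
      (\<integral>s. fredholm_minor k' n s \<partial>(\<Pi>\<^sub>M i\<in>{..<n}. half_line))) sums d'"
    by blast
  have "(\<integral>s. fredholm_minor k' n s \<partial>(\<Pi>\<^sub>M i\<in>{..<n}. half_line)) =
      (\<integral>s. fredholm_minor k n s \<partial>(\<Pi>\<^sub>M i\<in>{..<n}. half_line))" for n
    using kernel_of_unique[OF K' cont' K cont]
    by (intro Bochner_Integration.integral_cong refl fredholm_minor_cong)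
  then show "d' = d" using sums_unique2[OF sums] sums' by simp
qed (use assms in blast)

text \<open>Cauchy-Binet splits the minors and Andreief's identity integrates them; the
  factor \<open>n!\<close> cancels against the one in the Fredholm series. There are no sets of more than
  \<open>card Q\<close> indices, so the series is finite.\<close>

lemma fredholm_det_finite_rank:
  fixes a b :: "'q \<Rightarrow> real \<Rightarrow> complex"
  assumes Q: "finite Q"
    and en: "\<And>S. S \<subseteq> Q \<Longrightarrow> distinct (en S) \<and> set (en S) = S"
    and K: "kernel_of K (\<lambda>s t. \<Sum>q\<in>Q. a q s * b q t)"
    and cont: "\<And>q. q \<in> Q \<Longrightarrow> continuous_on {0<..} (a q)" "\<And>q. q \<in> Q \<Longrightarrow> continuous_on {0<..} (b q)"
    and int: "\<And>q r. q \<in> Q \<Longrightarrow> r \<in> Q \<Longrightarrow> integrable half_line (\<lambda>t. a q t * b r t)"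
  shows "fredholm_det K = (\<Sum>n = 0..card Q. (- 1) ^ n *
    (\<Sum>S | S \<subseteq> Q \<and> card S = n. det_on (en S) (en S) (\<lambda>q r. \<integral>t. a q t * b r t \<partial>half_line)))"
proof (rule fredholm_det_eqI[OF _ K])
  let ?k = "\<lambda>s t. \<Sum>q\<in>Q. a q s * b q t"
  let ?D = "\<lambda>n. \<Sum>S | S \<subseteq> Q \<and> card S = n. det_on (en S) (en S) (\<lambda>q r. \<integral>t. a q t * b r t \<partial>half_line)"
  have sf: "sigma_finite_measure half_line"
    by (intro sigma_finite_measure_restrict_space sigma_finite_lborel) simp
  show "continuous_on ({0<..} \<times> {0<..}) (\<lambda>(s, t). ?k s t)"
    unfolding case_prod_unfold
    by (intro continuous_on_sum continuous_on_mult)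
      (auto intro!: continuous_on_compose2[OF cont(1)] continuous_on_compose2[OF cont(2)] continuous_intros)
  have minor: "fredholm_minor ?k n = (\<lambda>s. \<Sum>S | S \<subseteq> Q \<and> card S = n.
      det_on (map s [0..<n]) (en S) (\<lambda>t q. a q t) * det_on (map s [0..<n]) (en S) (\<lambda>t q. b q t))" for n
  proof
    fix s
    have "fredholm_minor ?k n s = det_on (map s [0..<n]) (map s [0..<n]) ?k"
      unfolding fredholm_minor_def det_on_def
      by (intro arg_cong[where f = Determinant.det] Matrix.eq_matI) auto
    then show "fredholm_minor ?k n s = (\<Sum>S | S \<subseteq> Q \<and> card S = n.
        det_on (map s [0..<n]) (en S) (\<lambda>t q. a q t) * det_on (map s [0..<n]) (en S) (\<lambda>t q. b q t))"
      using Cauchy_Binet[OF Q en, of "map s [0..<n]" n "map s [0..<n]" "\<lambda>t q. a q t" "\<lambda>t q. b q t"]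
      by simp
  qed
  have S: "length (en S) = n" "\<And>q r. q \<in> set (en S) \<Longrightarrow> r \<in> set (en S) \<Longrightarrow>
      integrable half_line (\<lambda>t. a r t * b q t)" if "S \<in> {S. S \<subseteq> Q \<and> card S = n}" for S n
  proof -
    have SQ: "S \<subseteq> Q" "card S = n" using that by auto
    then have "distinct (en S)" "set (en S) = S" using en by auto
    then show "length (en S) = n" and "\<And>q r. q \<in> set (en S) \<Longrightarrow> r \<in> set (en S) \<Longrightarrow>
        integrable half_line (\<lambda>t. a r t * b q t)"
      using SQ distinct_card[of "en S"] int by (simp, blast)
  qed
  show "integrable (\<Pi>\<^sub>M i\<in>{..<n}. half_line) (fredholm_minor ?k n)" for n
    unfolding minor by (intro Bochner_Integration.integrable_sum Andreief(1)[OF sf] S)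
  have "(\<integral>s. fredholm_minor ?k n s \<partial>(\<Pi>\<^sub>M i\<in>{..<n}. half_line)) = fact n * ?D n" for n
  proof -
    let ?d = "\<lambda>S c s. det_on (map s [0..<n]) (en S) (\<lambda>t q. c q t :: complex)"
    have "(\<integral>s. fredholm_minor ?k n s \<partial>(\<Pi>\<^sub>M i\<in>{..<n}. half_line)) =
        (\<Sum>S | S \<subseteq> Q \<and> card S = n. \<integral>s. ?d S a s * ?d S b s \<partial>(\<Pi>\<^sub>M i\<in>{..<n}. half_line))"
      unfolding minor by (intro Bochner_Integration.integral_sum Andreief(1)[OF sf] S)
    also have "\<dots> = fact n * ?D n"
      unfolding sum_distrib_left by (intro sum.cong refl Andreief(2)[OF sf] S)
    finally show ?thesis .
  qed
  moreover have "?D n = 0" if "n \<notin> {0..card Q}" for n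
  proof -
    have "{S. S \<subseteq> Q \<and> card S = n} = {}"
      using that card_mono[OF Q] by auto
    then show ?thesis by (simp only: sum.empty)
  qed
  ultimately show "(\<lambda>n. (- 1) ^ n / fact n * (\<integral>s. fredholm_minor ?k n s \<partial>(\<Pi>\<^sub>M i\<in>{..<n}. half_line)))
      sums (\<Sum>n = 0..card Q. (- 1) ^ n * ?D n)"
    using sums_finite[of "{0..card Q}" "\<lambda>n. (- 1) ^ n * ?D n"] by simp
qed

section \<open>The tau function as a sum over minors\<close>

text \<open>The matrix of integrals has to be factored as \<open>A B\<^sup>T\<close> before the second use of Cauchy-Binet. The
  factorisation is left open here, because the scalar and the vector case use different
  ones: columns indexed by \<open>j\<close> in the first, by pairs \<open>(j, r)\<close> in the second.\<close>

lemma tau_exp_symbol: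
  fixes v :: "nat \<Rightarrow> 'e::complex_hilbert"
  assumes lam: "\<And>j. j \<in> {1..N} \<Longrightarrow> 0 < Re (lam j)"
    and Q: "finite Q"
    and en: "\<And>T. T \<subseteq> Q \<Longrightarrow> distinct (en T) \<and> set (en T) = T"
    and AB: "\<And>k l. k \<in> {1..N} \<Longrightarrow> l \<in> {1..N} \<Longrightarrow> (\<Sum>q\<in>Q. A k q * B l q) =
      (\<Sum>j = 1..N. cinner (v j) (v k) * exp (- 2 * lam k * complex_of_real x) *
        exp (- 2 * cnj (lam j) * complex_of_real x) /
        ((lam k + cnj (lam j)) * (lam l + cnj (lam j))))"
  shows "tau (exp_symbol N lam v) x = (\<Sum>n = 0..N. (- 1) ^ n *
    (\<Sum>S | S \<subseteq> {1..N} \<and> card S = n. \<Sum>T | T \<subseteq> Q \<and> card T = n.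
      det_on (sorted_list_of_set S) (en T) A * det_on (sorted_list_of_set S) (en T) B))"
proof -
  define w where "w j = exp (- 2 * cnj (lam j) * complex_of_real x) *\<^sub>C v j" for j
  have shift: "shift_symbol x (exp_symbol N lam v) = exp_symbol N lam w"
    by (rule ext, simp add: shift_symbol_def exp_symbol_def w_def scaleC_scaleC exp_add[symmetric]
        algebra_simps)
  let ?a = "\<lambda>k s. exp (- lam k * complex_of_real s)"
  let ?b = "\<lambda>k t. \<Sum>j = 1..N. cinner (w j) (w k) / (lam k + cnj (lam j)) * exp (- cnj (lam j) * complex_of_real t)"
  let ?en = "sorted_list_of_set :: nat set \<Rightarrow> nat list"
  have fin: "finite S" if "S \<subseteq> {1..N}" for S :: "nat set"
    using that by (rule finite_subset) simp
  have denom: "lam k + cnj (lam j) \<noteq> 0" if "k \<in> {1..N}" "j \<in> {1..N}" for k j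
    using lam[OF that(1)] lam[OF that(2)] by (auto simp: complex_eq_iff)
  have b_L2: "?b k \<in> L2" for k
    using lam by (intro L2_sum L2_bounded_linear[OF bounded_linear_mult_right] L2_exp) auto
  \<comment> \<open>The index of \<open>b\<close> becomes the row index of \<open>A\<close>, although it numbers the columns in the determinant; a transposition below reconciles the two.\<close>
  have gram: "(\<integral>t. ?a l t * ?b k t \<partial>half_line) = (\<Sum>q\<in>Q. A k q * B l q)"
    if k: "k \<in> {1..N}" and l: "l \<in> {1..N}" for k l
  proof -
    have "(\<integral>t. ?a l t * ?b k t \<partial>half_line) = laplace (?b k) (lam l)"
      by (simp add: laplace_def mult.commute)
    also have "\<dots> = (\<Sum>j = 1..N. cinner (w j) (w k) / (lam k + cnj (lam j)) *
        laplace (\<lambda>t. exp (- cnj (lam j) * complex_of_real t)) (lam l))"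
      using lam l by (intro laplace_sum L2_exp) auto
    also have "\<dots> = (\<Sum>q\<in>Q. A k q * B l q)"
      unfolding AB[OF k l]
    proof (rule sum.cong[OF refl])
      fix j assume j: "j \<in> {1..N}"
      have "laplace (\<lambda>t. exp (- cnj (lam j) * complex_of_real t)) (lam l) = 1 / (cnj (lam j) + lam l)"
        using lam[OF l] lam[OF j] by (intro laplace_exp) simp_all
      then show "cinner (w j) (w k) / (lam k + cnj (lam j)) *
          laplace (\<lambda>t. exp (- cnj (lam j) * complex_of_real t)) (lam l) =
        cinner (v j) (v k) * exp (- 2 * lam k * complex_of_real x) *
          exp (- 2 * cnj (lam j) * complex_of_real x) /
          ((lam k + cnj (lam j)) * (lam l + cnj (lam j)))"
        by (simp add: w_def cinner_scaleC_left cinner_scaleC_right exp_cnj mult_ac add.commute)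
    qed
    finally show ?thesis .
  qed
  have "tau (exp_symbol N lam v) x = fredholm_det (hankel_square (exp_symbol N lam w))"
    by (simp add: tau_def shift)
  also have "\<dots> = (\<Sum>n = 0..card {1..N}. (- 1) ^ n * (\<Sum>S | S \<subseteq> {1..N} \<and> card S = n.
      det_on (?en S) (?en S) (\<lambda>l k. \<integral>t. ?a l t * ?b k t \<partial>half_line)))"
  proof (rule fredholm_det_finite_rank)
    show "kernel_of (hankel_square (exp_symbol N lam w)) (\<lambda>s t. \<Sum>q = 1..N. ?a q s * ?b q t)"
      using lam by (rule kernel_of_hankel_square)
    show "integrable half_line (\<lambda>t. ?a q t * ?b r t)" if "q \<in> {1..N}" for q r
      using lam[OF that] by (intro L2_mult_integrable L2_exp b_L2)
  qed (use denom in \<open>auto simp: fin intro!: continuous_intros\<close>)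
  also have "\<dots> = (\<Sum>n = 0..N. (- 1) ^ n * (\<Sum>S | S \<subseteq> {1..N} \<and> card S = n.
      \<Sum>T | T \<subseteq> Q \<and> card T = n. det_on (?en S) (en T) A * det_on (?en S) (en T) B))"
  proof (intro sum.cong arg_cong2[where f = "(*)"] refl)
    fix n S assume S: "S \<in> {S. S \<subseteq> {1..N} \<and> card S = n}"
    then have len: "length (?en S) = n" and set: "set (?en S) = S"
      using fin[of S] by auto
    have "det_on (?en S) (?en S) (\<lambda>l k. \<integral>t. ?a l t * ?b k t \<partial>half_line) =
        det_on (?en S) (?en S) (\<lambda>l k. \<Sum>q\<in>Q. A k q * B l q)"
      using S set by (intro det_on_cong gram) auto
    also have "\<dots> = det_on (?en S) (?en S) (\<lambda>k l. \<Sum>q\<in>Q. A k q * B l q)"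
      by (rule det_on_transpose) simp
    also have "\<dots> = (\<Sum>T | T \<subseteq> Q \<and> card T = n. det_on (?en S) (en T) A * det_on (?en S) (en T) B)"
      by (rule Cauchy_Binet[OF Q en len len])
    finally show "det_on (?en S) (?en S) (\<lambda>l k. \<integral>t. ?a l t * ?b k t \<partial>half_line) = \<dots>" .
  qed simp
  finally show ?thesis .
qed

lemma cinner_dagger:
  assumes "orthonormal_basis \<nu> e"
  shows "cinner (dagger \<nu> e u) (dagger \<nu> e v) = (\<Sum>r = 1..\<nu>. cnj (cinner u (e r)) * cinner v (e r))"
proof -
  have "cinner (dagger \<nu> e u) (dagger \<nu> e v) =
      (\<Sum>r = 1..\<nu>. \<Sum>s = 1..\<nu>. cnj (cinner u (e r)) * (cinner v (e s) * cinner (e r) (e s)))"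
    unfolding dagger_def cinner_sum_left cinner_scaleC_left
    unfolding cinner_sum_right cinner_scaleC_right sum_distrib_left by simp
  also have "\<dots> = (\<Sum>r = 1..\<nu>. \<Sum>s = 1..\<nu>.
      if r = s then cnj (cinner u (e r)) * cinner v (e s) else 0)"
    using assms by (intro sum.cong refl) (simp add: orthonormal_basis_def)
  finally show ?thesis by (simp add: sum.delta)
qed

lemma pairs_list_enumerates:
  assumes "T \<subseteq> {1..N} \<times> {1..\<nu>}"
  shows "distinct (pairs_list N \<nu> T) \<and> set (pairs_list N \<nu> T) = T"
  using assms by (auto simp: pairs_list_def distinct_product less_Suc_eq_le)

theorem proposition6p4:
  fixes N :: nat and lam :: "nat \<Rightarrow> complex" and x :: real
  assumes "\<And>j. j \<in> {1..N} \<Longrightarrow> Re (lam j) > 0"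
    and "exps_independent N lam"
    and "x \<ge> 0"
  shows "(\<forall>\<xi> :: nat \<Rightarrow> complex.
      tau (exp_symbol N lam (\<lambda>j. cnj (\<xi> j))) x =
        (\<Sum>l = 0..N. (- 1) ^ l *
          (\<Sum>(T, S) \<in> {(T, S). T \<subseteq> {1..N} \<and> S \<subseteq> {1..N} \<and> card S = l \<and> card T = l}.
            (\<Prod>j\<in>S. \<xi> j * exp (- 2 * lam j * complex_of_real x)) *
            (\<Prod>k\<in>T. cnj (\<xi> k) * exp (- 2 * cnj (lam k) * complex_of_real x)) *
            (det_on (sorted_list_of_set S) (sorted_list_of_set T)
              (\<lambda>j k. 1 / (lam j + cnj (lam k))))\<^sup>2)))
    \<and>
    (\<forall>(\<nu> :: nat) (e :: nat \<Rightarrow> 'e::complex_hilbert) (\<xi> :: nat \<Rightarrow> 'e).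
      orthonormal_basis \<nu> e \<longrightarrow>
      tau (exp_symbol N lam (\<lambda>j. dagger \<nu> e (\<xi> j))) x =
        (\<Sum>(S, T) \<in> {(S, T). S \<subseteq> {1..N} \<and> T \<subseteq> {1..N} \<times> {1..\<nu>} \<and> card S = card T}.
          (- 1) ^ card S *
          det_on (sorted_list_of_set S) (pairs_list N \<nu> T)
            (\<lambda>j (k, r). cinner (\<xi> j) (e r) * exp (- 2 * lam j * complex_of_real x)
              / (lam j + cnj (lam k))) *
          det_on (sorted_list_of_set S) (pairs_list N \<nu> T)
            (\<lambda>m (k, r). cnj (cinner (\<xi> k) (e r)) * exp (- 2 * cnj (lam k) * complex_of_real x)
              / (lam m + cnj (lam k)))))"
proof (intro conjI allI impI)
  note lam = assms(1)
  let ?en = "sorted_list_of_set :: nat set \<Rightarrow> nat list"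
  let ?C = "\<lambda>j k. 1 / (lam j + cnj (lam k))"
  fix \<xi> :: "nat \<Rightarrow> complex"
  let ?u = "\<lambda>j. \<xi> j * exp (- 2 * lam j * complex_of_real x)"
  let ?v = "\<lambda>k. cnj (\<xi> k) * exp (- 2 * cnj (lam k) * complex_of_real x)"
  have fin: "finite S" if "S \<subseteq> {1..N}" for S :: "nat set"
    using that by (rule finite_subset) simp
  \<comment> \<open>All numerators go into the first factor, so that the second one is the bare Cauchy matrix.\<close>
  have "tau (exp_symbol N lam (\<lambda>j. cnj (\<xi> j))) x = (\<Sum>l = 0..N. (- 1) ^ l *
      (\<Sum>S | S \<subseteq> {1..N} \<and> card S = l. \<Sum>T | T \<subseteq> {1..N} \<and> card T = l.
        det_on (?en S) (?en T) (\<lambda>j k. ?u j * ?v k * ?C j k) * det_on (?en S) (?en T) ?C))"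
  proof (rule tau_exp_symbol[OF lam])
    fix k l
    show "(\<Sum>q = 1..N. ?u k * ?v q * ?C k q * ?C l q) = (\<Sum>j = 1..N. cinner (cnj (\<xi> j)) (cnj (\<xi> k)) *
        exp (- 2 * lam k * complex_of_real x) * exp (- 2 * cnj (lam j) * complex_of_real x) /
        ((lam k + cnj (lam j)) * (lam l + cnj (lam j))))"
      by (intro sum.cong refl) (simp add: cinner_complex_def mult_ac)
  qed (auto simp: fin)
  also have "\<dots> = (\<Sum>l = 0..N. (- 1) ^ l *
      (\<Sum>S | S \<subseteq> {1..N} \<and> card S = l. \<Sum>T | T \<subseteq> {1..N} \<and> card T = l.
        (\<Prod>j\<in>S. ?u j) * (\<Prod>k\<in>T. ?v k) * (det_on (?en S) (?en T) ?C)\<^sup>2))"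
  proof (rule sum.cong[OF refl], rule arg_cong2[where f = "(*)", OF refl],
      rule sum.cong[OF refl], rule sum.cong[OF refl])
    fix l S T
    assume "S \<in> {S. S \<subseteq> {1..N} \<and> card S = l}" "T \<in> {T. T \<subseteq> {1..N} \<and> card T = l}"
    then have "finite S" "finite T" "card S = card T" using fin by auto
    then have "det_on (?en S) (?en T) (\<lambda>j k. ?u j * ?v k * ?C j k) =
        (\<Prod>j\<in>S. ?u j) * (\<Prod>k\<in>T. ?v k) * det_on (?en S) (?en T) ?C"
      by (subst det_on_scale) simp_all
    then show "det_on (?en S) (?en T) (\<lambda>j k. ?u j * ?v k * ?C j k) * det_on (?en S) (?en T) ?C =
        (\<Prod>j\<in>S. ?u j) * (\<Prod>k\<in>T. ?v k) * (det_on (?en S) (?en T) ?C)\<^sup>2"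
      by (simp only: power2_eq_square mult.assoc)
  qed
  also have "\<dots> = (\<Sum>l = 0..N. (- 1) ^ l *
      (\<Sum>(T, S) \<in> {(T, S). T \<subseteq> {1..N} \<and> S \<subseteq> {1..N} \<and> card S = l \<and> card T = l}.
        (\<Prod>j\<in>S. ?u j) * (\<Prod>k\<in>T. ?v k) * (det_on (?en S) (?en T) ?C)\<^sup>2))"
  proof (intro sum.cong refl arg_cong2[where f = "(*)"])
    fix l
    have "{(T, S). T \<subseteq> {1..N} \<and> S \<subseteq> {1..N} \<and> card S = l \<and> card T = l} =
        {T. T \<subseteq> {1..N} \<and> card T = l} \<times> {S. S \<subseteq> {1..N} \<and> card S = l}"
      by auto
    then show "(\<Sum>S | S \<subseteq> {1..N} \<and> card S = l. \<Sum>T | T \<subseteq> {1..N} \<and> card T = l.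
          (\<Prod>j\<in>S. ?u j) * (\<Prod>k\<in>T. ?v k) * (det_on (?en S) (?en T) ?C)\<^sup>2) =
        (\<Sum>(T, S) \<in> {(T, S). T \<subseteq> {1..N} \<and> S \<subseteq> {1..N} \<and> card S = l \<and> card T = l}.
          (\<Prod>j\<in>S. ?u j) * (\<Prod>k\<in>T. ?v k) * (det_on (?en S) (?en T) ?C)\<^sup>2)"
      by (subst sum.swap) (simp only: sum.cartesian_product)
  qed
  finally show "tau (exp_symbol N lam (\<lambda>j. cnj (\<xi> j))) x = \<dots>" .
next
  note lam = assms(1)
  let ?en = "sorted_list_of_set :: nat set \<Rightarrow> nat list"
  fix \<nu> :: nat and e \<xi> :: "nat \<Rightarrow> 'e"
  assume e: "orthonormal_basis \<nu> e"
  let ?Q = "{1..N} \<times> {1..\<nu>}"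
  let ?A = "\<lambda>j (k, r). cinner (\<xi> j) (e r) * exp (- 2 * lam j * complex_of_real x)
              / (lam j + cnj (lam k))"
  let ?B = "\<lambda>m (k, r). cnj (cinner (\<xi> k) (e r)) * exp (- 2 * cnj (lam k) * complex_of_real x)
              / (lam m + cnj (lam k))"
  let ?ST = "{(S, T). S \<subseteq> {1..N} \<and> T \<subseteq> ?Q \<and> card S = card T}"
  let ?F = "\<lambda>S T. (- 1) ^ card S * det_on (?en S) (pairs_list N \<nu> T) ?A *
    det_on (?en S) (pairs_list N \<nu> T) ?B"
  have "tau (exp_symbol N lam (\<lambda>j. dagger \<nu> e (\<xi> j))) x = (\<Sum>n = 0..N. (- 1) ^ n *
      (\<Sum>S | S \<subseteq> {1..N} \<and> card S = n. \<Sum>T | T \<subseteq> ?Q \<and> card T = n.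
        det_on (?en S) (pairs_list N \<nu> T) ?A * det_on (?en S) (pairs_list N \<nu> T) ?B))"
  proof (rule tau_exp_symbol[OF lam _ pairs_list_enumerates])
    fix k l
    have "(\<Sum>q\<in>?Q. ?A k q * ?B l q) = (\<Sum>j = 1..N. \<Sum>r = 1..\<nu>. ?A k (j, r) * ?B l (j, r))"
      by (simp add: sum.cartesian_product case_prod_unfold)
    also have "\<dots> = (\<Sum>j = 1..N. cinner (dagger \<nu> e (\<xi> j)) (dagger \<nu> e (\<xi> k)) *
        exp (- 2 * lam k * complex_of_real x) * exp (- 2 * cnj (lam j) * complex_of_real x) /
        ((lam k + cnj (lam j)) * (lam l + cnj (lam j))))"
      unfolding cinner_dagger[OF e] sum_distrib_right sum_divide_distrib
      by (intro sum.cong refl) (simp add: mult_ac)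
    finally show "(\<Sum>q\<in>?Q. ?A k q * ?B l q) = \<dots>" .
  qed auto
  \<comment> \<open>From here on the terms are only regrouped: the pairs \<open>(S, T)\<close> are collected by the common cardinality \<open>n\<close>.\<close>
  also have "\<dots> = (\<Sum>n = 0..N. \<Sum>(S, T) | (S, T) \<in> ?ST \<and> card S = n. ?F S T)"
  proof (rule sum.cong[OF refl])
    fix n
    have "{z. case z of (S, T) \<Rightarrow> (S, T) \<in> ?ST \<and> card S = n} =
        {S. S \<subseteq> {1..N} \<and> card S = n} \<times> {T. T \<subseteq> ?Q \<and> card T = n}"
      by auto
    then show "(- 1) ^ n * (\<Sum>S | S \<subseteq> {1..N} \<and> card S = n. \<Sum>T | T \<subseteq> ?Q \<and> card T = n.
        det_on (?en S) (pairs_list N \<nu> T) ?A * det_on (?en S) (pairs_list N \<nu> T) ?B) =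
      (\<Sum>(S, T) | (S, T) \<in> ?ST \<and> card S = n. ?F S T)"
      by (simp only: sum.cartesian_product[symmetric] sum_distrib_left)
        (intro sum.cong refl, simp add: mult.assoc)
  qed
  also have "\<dots> = (\<Sum>n = 0..N. \<Sum>z | z \<in> ?ST \<and> card (fst z) = n. case z of (S, T) \<Rightarrow> ?F S T)"
    by (simp add: case_prod_unfold)
  also have "\<dots> = (\<Sum>(S, T) \<in> ?ST. ?F S T)"
  proof (rule sum.group)
    have "?ST \<subseteq> Pow {1..N} \<times> Pow ?Q" by auto
    then show "finite ?ST" by (rule finite_subset) simp
    show "(\<lambda>z. card (fst z)) ` ?ST \<subseteq> {0..N}"
    proof (rule image_subsetI)
      fix z assume "z \<in> ?ST"
      then have "fst z \<subseteq> {1..N}" by auto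
      then show "card (fst z) \<in> {0..N}"
        using card_mono[of "{1..N}" "fst z"] by simp
    qed
  qed simp
  finally show "tau (exp_symbol N lam (\<lambda>j. dagger \<nu> e (\<xi> j))) x = (\<Sum>(S, T) \<in> ?ST. ?F S T)" .
qed

end
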